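(* Let $\rho:\mathbb{R}\to\mathbb{R}$ be a non-affine continuous function that is continuously differentiable at some point $c\in\mathbb{R}$ with $\rho'(c)\neq0$. Let $n,m\ge 1$, let $\mathcal{K}\subset\mathbb{R}^n$ be compact, let $N=n+m+2$, and let $r\ge 1$ be an integer. Then the class of Deep DLoR Neural Networks with activation $\rho$, arbitrary depth and width $N$, in which every hidden weight matrix is of the form $\alpha I_N+UV^T$ with $\alpha\in\mathbb{R}$ and $U,V\in\mathbb{R}^{N\times r}$, is dense in $C(\mathcal{K},\mathbb{R}^m)$ with respect to the uniform norm.
   Context: $\rho$ is applied entrywise to vectors. "Continuously differentiable at $c$" means that $\rho$ is differentiable in a neighbourhood of $c$ and $\rho'$ is continuous at $c$. $C(\mathcal{K},\mathbb{R}^m)$ is the space of continuous functions $\mathcal{K}\to\mathbb{R}^m$ with norm $\|f\|_\infty=\sup_{x\in\mathcal{K}}\|f(x)\|_2$. A Diagonal plus Low-Rank (DLoR) component of rank $r$ is a matrix $M=\alpha I_N+UV^T\in\mathbb{R}^{N\times N}$ with $\alpha\in\mathbb{R}$ and $U,V\in\mathbb{R}^{N\times r}$. A Deep DLoR Neural Network of width $N$ and depth $T\ge1$ (any $T$) is a map $x\mapsto A\,(\mathcal{L}_T\circ\cdots\circ\mathcal{L}_1)(\tilde x)+a$, where $\tilde x=(x,0)\in\mathbb{R}^N$ is the input $x\in\mathbb{R}^n$ padded by zeros, each hidden layer is $\mathcal{L}_t(z)=\rho(M_tz+b_t)$ with $M_t\in\mathbb{R}^{N\times N}$ a DLoR component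 of rank $r$ and $b_t\in\mathbb{R}^N$ (the scalar $\alpha$, the factors $U,V$ and the bias may vary with $t$), and $A\in\mathbb{R}^{m\times N}$, $a\in\mathbb{R}^m$ give an affine output readout. *)

theory Defs
  imports "HOL-Analysis.Analysis" "HOL-Library.Numeral_Type"
begin

definition affine_fun :: "(real \<Rightarrow> real) \<Rightarrow> bool" where
  "affine_fun \<rho> \<longleftrightarrow> (\<exists>a b. \<forall>x. \<rho> x = a * x + b)"

definition continuously_differentiable_at :: "(real \<Rightarrow> real) \<Rightarrow> real \<Rightarrow> bool" where
  "continuously_differentiable_at \<rho> c \<longleftrightarrow>
     (\<forall>\<^sub>F x in nhds c. \<rho> differentiable (at x)) \<and> isCont (deriv \<rho>) c"

text \<open>The rank bound is the cardinality of the index type \<open>'r\<close>, the width that of \<open>'w\<close>.\<close>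

definition dlor_components :: "'r::finite itself \<Rightarrow> (real^'w^'w) set" where
  "dlor_components _ =
     {\<alpha> *\<^sub>R mat 1 + U ** transpose V | \<alpha> (U :: real^'r^'w) (V :: real^'r^'w). True}"

text \<open>The coordinates of the hidden space are indexed by \<open>'n + 'k\<close>: the left summand carries the
  input, the right summand the zero padding, so the width is \<open>CARD('n) + CARD('k)\<close>.\<close>

definition zero_pad :: "real^'n \<Rightarrow> real^('n + 'k::finite)" where
  "zero_pad x = (\<chi> i. case i of Inl j \<Rightarrow> x $ j | Inr _ \<Rightarrow> 0)"

definition hidden_layer :: "(real \<Rightarrow> real) \<Rightarrow> (real^'w^'w) \<times> (real^'w) \<Rightarrow> real^'w \<Rightarrow> real^'w" where
  "hidden_layer \<rho> = (\<lambda>(M, b) z. \<chi> i. \<rho> ((M *v z + b) $ i))"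

text \<open>\<open>fold\<close> applies the head of the list first, so \<open>[L\<^sub>1, \<dots>, L\<^sub>T]\<close> yields
  \<open>L\<^sub>T \<circ> \<dots> \<circ> L\<^sub>1\<close>.\<close>

definition deep_net ::
  "(real \<Rightarrow> real) \<Rightarrow> ((real^('n + 'k::finite)^('n + 'k)) \<times> (real^('n + 'k))) list \<Rightarrow>
   real^('n + 'k)^'m \<Rightarrow> real^'m \<Rightarrow> real^'n \<Rightarrow> real^'m" where
  "deep_net \<rho> Ls A a x = A *v fold (hidden_layer \<rho>) Ls (zero_pad x) + a"

definition deep_dlor_networks ::
  "(real \<Rightarrow> real) \<Rightarrow> 'r::finite itself \<Rightarrow> 'k::finite itself \<Rightarrow> (real^'n \<Rightarrow> real^'m) set" where
  "deep_dlor_networks \<rho> R _ =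
     {deep_net \<rho> Ls A a | (Ls :: ((real^('n + 'k)^('n + 'k)) \<times> (real^('n + 'k))) list) A a.
        Ls \<noteq> [] \<and> (\<forall>(M, b) \<in> set Ls. M \<in> dlor_components R)}"

text \<open>In \<^const>\<open>cfunspace\<close>, functions are extensional, i.e. \<open>undefined\<close> off \<open>K\<close>, and the
  distance is the supremum over \<open>K\<close> of the pointwise Euclidean distance; boundedness is automatic
  for compact \<open>K\<close>.\<close>

definition dense_in_C :: "(real^'n) set \<Rightarrow> (real^'n \<Rightarrow> real^'m) set \<Rightarrow> bool" where
  "dense_in_C K F \<longleftrightarrow>
     (let C = cfunspace (top_of_set K) (euclidean_metric :: (real^'m) metric);
          F\<^sub>K = (\<lambda>f. restrict f K) ` F
      in F\<^sub>K \<subseteq> mspace C \<and> mtopology_of C closure_of F\<^sub>K = mspace C)"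

end

theory Submission
  imports Defs
begin

text \<open>
  With \<open>M = \<alpha> I + e\<^sub>i v\<^sup>T\<close> and small \<open>\<alpha>\<close>, a single layer evaluates one neuron \<open>\<rho> (v \<bullet> z + b)\<close> in
  coordinate \<open>i\<close> and carries the other coordinates along unchanged up to an affine rescaling, since
  \<open>\<rho> (c + \<alpha> z) \<approx> \<rho> c + \<alpha> \<rho>' c z\<close>. So one may program with \<open>n\<close> input registers, \<open>m\<close> output registers, a
  working register \<open>s\<close> and a scratch register \<open>t\<close>, using affine updates and single-neuron updates of
  one register, compositions, and locally uniform limits.

  Through \<open>t\<close> one obtains the updates \<open>s := s + h \<rho> (a s + b l + c)\<close> with \<open>l = w \<bullet> x\<close>. To first order
  in \<open>h\<close> such steps add up, so the velocity fields they generate form a closed linear space. A closed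
  linear space of functions on the line that is invariant under \<open>x \<mapsto> a x + b\<close> and contains a
  non-affine \<open>\<rho>\<close> contains \<open>x\<^sup>2\<close>: average \<open>\<rho>\<close> twice to make it \<open>C\<^sup>2\<close>, then take rescaled second
  differences. By polarization the field \<open>s l\<close> is available; its flow over unit time multiplies
  \<open>s\<close> by \<open>exp (w \<bullet> x)\<close>. Linear combinations of these exponentials, accumulated in the output
  registers, are dense by the Stone-Weierstrass theorem.
\<close>

section \<open>Closed dilation-invariant spaces of functions on the line\<close>

text \<open>Closedness for uniform convergence on balls, with an approximant that may depend on the
  ball and the tolerance. The limit is taken to be continuous from the outset, so instances do not
  have to derive this.\<close>

definition locally_uniformly_closed ::
  "('a::real_normed_vector \<Rightarrow> 'b::real_normed_vector) set \<Rightarrow> bool" where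
  "locally_uniformly_closed S \<longleftrightarrow>
     (\<forall>f. continuous_on UNIV f \<longrightarrow>
        (\<forall>B. \<forall>\<epsilon>>0. \<exists>g\<in>S. \<forall>x. norm x \<le> B \<longrightarrow> norm (g x - f x) \<le> \<epsilon>) \<longrightarrow> f \<in> S)"

lemma locally_uniformly_closedD:
  assumes "locally_uniformly_closed S" "continuous_on UNIV f"
    and "\<And>B \<epsilon>. \<epsilon> > 0 \<Longrightarrow> \<exists>g\<in>S. \<forall>x. norm x \<le> B \<longrightarrow> norm (g x - f x) \<le> \<epsilon>"
  shows "f \<in> S"
  using assms unfolding locally_uniformly_closed_def by blast

section \<open>Calculus on the line: vanishing second differences and a Taylor bound\<close>

lemma continuous_real_antiderivative:
  fixes f :: "real \<Rightarrow> real"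
  assumes "continuous_on UNIV f"
  obtains F where "\<And>x. (F has_real_derivative f x) (at x)"
proof -
  have "\<exists>F. \<forall>x::real. (-\<infinity>::ereal) < x \<longrightarrow> x < (\<infinity>::ereal) \<longrightarrow> (F has_vector_derivative f x) (at x)"
    using assms by (intro einterval_antiderivative) (auto simp: continuous_on_eq_continuous_at)
  then show thesis
    using that by (auto simp: has_real_derivative_iff_has_vector_derivative)
qed

lemma affine_fun_if_second_difference_zero:
  fixes \<rho> :: "real \<Rightarrow> real"
  assumes cont: "continuous_on UNIV \<rho>"
    and zero: "\<And>x \<eta>. \<rho> (x + 2 * \<eta>) - 2 * \<rho> (x + \<eta>) + \<rho> x = 0"
  shows "affine_fun \<rho>"
proof -
  obtain F where F: "\<And>x. (F has_real_derivative \<rho> x) (at x)"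
    using continuous_real_antiderivative[OF cont] by metis
  note [derivative_intros] = DERIV_chain2[OF F]
  text \<open>Integrating the hypothesis over \<open>\<eta> \<in> [0, 1]\<close> expresses \<open>\<rho>\<close> through its antiderivative,
    so \<open>\<rho>\<close> is differentiable.\<close>
  have \<rho>_eq: "\<rho> = (\<lambda>x. 2 * F (x + 1) - F (x + 2) / 2 - 3 / 2 * F x)"
  proof
    fix x
    let ?\<phi> = "\<lambda>\<eta>. F (x + 2 * \<eta>) / 2 - 2 * F (x + \<eta>) + \<rho> x * \<eta>"
    have "(?\<phi> has_real_derivative 0) (at \<eta>)" for \<eta>
      using zero[of x \<eta>] by (auto intro!: derivative_eq_intros)
    then have "?\<phi> 1 = ?\<phi> 0"
      by (intro DERIV_isconst_all) blast
    then show "\<rho> x = 2 * F (x + 1) - F (x + 2) / 2 - 3 / 2 * F x"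
      by simp
  qed
  \<comment> \<open>Differentiating the formula for \<open>\<rho>\<close> and eliminating
    \<open>\<rho> (x + 2)\<close> by the hypothesis with step 1 leaves exactly this
    derivative.\<close>
  define D where "D x = \<rho> (x + 1) - \<rho> x" for x
  have D: "(\<rho> has_real_derivative D x) (at x)" for x
  proof -
    have "((\<lambda>x. 2 * F (x + 1) - F (x + 2) / 2 - 3 / 2 * F x) has_real_derivative D x) (at x)"
      using zero[of x 1] by (auto intro!: derivative_eq_intros simp: D_def algebra_simps)
    then show ?thesis
      using \<rho>_eq by metis
  qed
  note [derivative_intros] = DERIV_chain2[OF D]
  \<comment> \<open>Differentiate the hypothesis in the step \<eta>. With base point
    \<open>- b\<close> and \<eta> = b, the two moving points are b and 0.\<close>
  have D_const: "D b = D 0" for b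
  proof -
    have eq: "(\<lambda>\<eta>. \<rho> (- b + 2 * \<eta>) - 2 * \<rho> (- b + \<eta>)) = (\<lambda>\<eta>. - \<rho> (- b))"
      using zero[of "- b"] by (auto simp: fun_eq_iff algebra_simps)
    have "((\<lambda>\<eta>. \<rho> (- b + 2 * \<eta>) - 2 * \<rho> (- b + \<eta>)) has_real_derivative 2 * D b - 2 * D 0) (at b)"
      by (auto intro!: derivative_eq_intros)
    moreover have "((\<lambda>\<eta>. - \<rho> (- b)) has_real_derivative 0) (at b)"
      by simp
    ultimately show ?thesis
      unfolding eq using DERIV_unique by fastforce
  qed
  have "((\<lambda>x. \<rho> x - D 0 * x) has_real_derivative 0) (at x)" for x
    using D_const[of x] by (auto intro!: derivative_eq_intros)
  then have "\<rho> x - D 0 * x = \<rho> 0 - D 0 * 0" for x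
    by (intro DERIV_isconst_all) blast
  then show ?thesis
    unfolding affine_fun_def by (metis add.commute diff_eq_eq diff_zero mult_zero_right)
qed

text \<open>Peano form: the second derivative is required at the single point \<open>x\<close>.
  There it bounds the derivative of the remainder by \<epsilon> times the distance, and the mean
  value inequality supplies the second factor.\<close>

lemma second_order_Taylor_bound:
  fixes q q' :: "real \<Rightarrow> real"
  assumes q: "\<And>x. (q has_real_derivative q' x) (at x)"
    and q': "(q' has_real_derivative D) (at x)" and "\<epsilon> > 0"
  obtains \<delta> where "\<delta> > 0"
    and "\<And>y. \<bar>y\<bar> < \<delta> \<Longrightarrow> \<bar>q (x + y) - q x - q' x * y - D * y\<^sup>2 / 2\<bar> \<le> \<epsilon> * y\<^sup>2"
proof -
  note [derivative_intros] = DERIV_chain2[OF q]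
  define r where "r y = q (x + y) - q x - q' x * y - D * y\<^sup>2 / 2" for y
  have r: "(r has_real_derivative q' (x + y) - q' x - D * y) (at y)" for y
    unfolding r_def by (auto intro!: derivative_eq_intros)
  from q' have "\<exists>d>0. \<forall>y. norm (y - x) < d \<longrightarrow> norm (q' y - q' x - (y - x) * D) \<le> \<epsilon> * norm (y - x)"
    using \<open>\<epsilon> > 0\<close> unfolding has_field_derivative_def has_derivative_at_alt
    by (auto simp: mult.commute)
  then obtain d where d: "d > 0"
    "\<And>y. norm (y - x) < d \<Longrightarrow> norm (q' y - q' x - (y - x) * D) \<le> \<epsilon> * norm (y - x)"
    by blast
  show thesis
  proof (rule that[OF d(1)])
    fix y :: real
    assume y: "\<bar>y\<bar> < d"
    have "norm (r y - r 0) \<le> (\<epsilon> * \<bar>y\<bar>) * norm (y - 0)"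
    proof (rule field_differentiable_bound[of "closed_segment 0 y" r "\<lambda>y. q' (x + y) - q' x - D * y"])
      fix z assume z: "z \<in> closed_segment 0 y"
      then have "\<bar>z\<bar> \<le> \<bar>y\<bar>"
        by (auto simp: closed_segment_eq_real_ivl split: if_splits)
      then have "norm (q' (x + z) - q' x - D * z) \<le> \<epsilon> * \<bar>z\<bar>"
        using d(2)[of "x + z"] y by (simp add: mult.commute)
      also have "\<dots> \<le> \<epsilon> * \<bar>y\<bar>"
        using \<open>\<bar>z\<bar> \<le> \<bar>y\<bar>\<close> \<open>\<epsilon> > 0\<close> by simp
      finally show "norm (q' (x + z) - q' x - D * z) \<le> \<epsilon> * \<bar>y\<bar>" .
    qed (auto intro: has_field_derivative_at_within r)
    then show "\<bar>q (x + y) - q x - q' x * y - D * y\<^sup>2 / 2\<bar> \<le> \<epsilon> * y\<^sup>2"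
      by (simp add: r_def power2_eq_square abs_mult_self_eq mult.assoc)
  qed
qed

text \<open>Instantiated in \<open>fields_square\<close> by the profiles \<open>g\<close> whose
  compositions with all affine functions of \<open>(l, s)\<close> are admissible velocity
  fields.\<close>

locale dilation_invariant_space =
  fixes G :: "(real \<Rightarrow> real) set"
  assumes cont: "g \<in> G \<Longrightarrow> continuous_on UNIV g"
    and add: "f \<in> G \<Longrightarrow> g \<in> G \<Longrightarrow> (\<lambda>x. f x + g x) \<in> G"
    and scale: "g \<in> G \<Longrightarrow> (\<lambda>x. a * g x) \<in> G"
    and dilate: "g \<in> G \<Longrightarrow> (\<lambda>x. g (a * x + b)) \<in> G"
    and closed: "locally_uniformly_closed G"
begin

lemma sum_mem: "(\<And>k. g k \<in> G) \<Longrightarrow> (\<lambda>x. \<Sum>k<(n::nat). g k x) \<in> G"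
proof (induction n)
  case 0
  then show ?case
    using scale[of "g 0" 0] by simp
next
  case (Suc n)
  then show ?case
    using add[of "\<lambda>x. \<Sum>k<n. g k x" "g n"] by simp
qed

text \<open>\<open>F (x + \<eta>) - F x\<close> is the integral of \<open>g\<close> over \<open>[x, x + \<eta>]\<close>, a locally uniform limit of
  Riemann sums.\<close>

lemma antiderivative_difference:
  assumes g: "g \<in> G" and F: "\<And>x. (F has_real_derivative g x) (at x)"
    and "\<eta> > 0"
  shows "(\<lambda>x. F (x + \<eta>) - F x) \<in> G"
proof (rule locally_uniformly_closedD[OF closed])
  have "continuous_on UNIV F"
    using F by (meson DERIV_continuous continuous_at_imp_continuous_on)
  then show "continuous_on UNIV (\<lambda>x. F (x + \<eta>) - F x)"
    by (intro continuous_on_diff continuous_on_compose2[of UNIV F UNIV "\<lambda>x. x + \<eta>"] continuous_intros) auto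
  fix B \<epsilon> :: real
  assume "\<epsilon> > 0"
  \<comment> \<open>The tolerance \<epsilon> / \<eta> per unit length adds up to \<epsilon> over an
    interval of length \<eta>.\<close>
  have "uniformly_continuous_on {-B..B + \<eta>} g"
    by (intro compact_uniformly_continuous continuous_on_subset[OF cont[OF g]]) auto
  then obtain d where d: "d > 0"
    "\<And>x y. x \<in> {-B..B + \<eta>} \<Longrightarrow> y \<in> {-B..B + \<eta>} \<Longrightarrow> \<bar>y - x\<bar> < d \<Longrightarrow> \<bar>g y - g x\<bar> < \<epsilon> / \<eta>"
    using divide_pos_pos[OF \<open>\<epsilon> > 0\<close> \<open>\<eta> > 0\<close>] unfolding uniformly_continuous_on_def dist_real_def
    by (smt (verit))
  obtain N :: nat where N: "N > \<eta> / d"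
    using reals_Archimedean2 by blast
  then have "N > 0"
    using \<open>\<eta> > 0\<close> \<open>d > 0\<close> by (metis divide_pos_pos of_nat_0_less_iff order_less_trans)
  define h where "h = \<eta> / N"
  have h: "h > 0" "h < d" "h * N = \<eta>"
    using N \<open>N > 0\<close> \<open>\<eta> > 0\<close> \<open>d > 0\<close> by (auto simp: h_def field_simps)
  \<comment> \<open>Left Riemann sum; the factor 1 puts each summand into the form of
    \<open>dilate\<close>.\<close>
  let ?S = "\<lambda>x. \<Sum>k<N. h * g (1 * x + k * h)"
  have "?S \<in> G"
    by (intro sum_mem g scale dilate)
  moreover have "norm (?S x - (F (x + \<eta>) - F x)) \<le> \<epsilon>" if "norm x \<le> B" for x
  proof -
    have "F (x + \<eta>) - F x = (\<Sum>k<N. F (x + Suc k * h) - F (x + k * h))"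
      using sum_lessThan_telescope[of "\<lambda>k. F (x + k * h)" N] h(3) by (simp add: mult.commute)
    then have "?S x - (F (x + \<eta>) - F x) =
        (\<Sum>k<N. h * g (x + k * h) - (F (x + Suc k * h) - F (x + k * h)))"
      by (simp add: sum_subtractf)
    also have "norm \<dots> \<le> (\<Sum>k<N. h * (\<epsilon> / \<eta>))"
    proof (rule sum_norm_le)
      fix k assume "k \<in> {..<N}"
      have lt: "x + k * h < x + Suc k * h"
        using h by simp
      then obtain z where z: "x + k * h < z" "z < x + Suc k * h"
        "F (x + Suc k * h) - F (x + k * h) = (x + Suc k * h - (x + k * h)) * g z"
        using MVT2[of "x + k * h" "x + Suc k * h" F g] F by blast
      have "Suc k * h \<le> N * h"
        using \<open>k \<in> {..<N}\<close> h by (intro mult_right_mono) auto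
      then have le: "Suc k * h \<le> \<eta>"
        using h by (simp add: mult.commute)
      have "0 \<le> k * h"
        using h by simp
      then have "- B \<le> x + k * h" "x + Suc k * h \<le> B + \<eta>" "x + Suc k * h = x + k * h + h"
        using le that unfolding abs_le_iff real_norm_def by (linarith, linarith, simp add: ring_distribs)
      then have "x + k * h \<in> {-B..B + \<eta>}" "z \<in> {-B..B + \<eta>}" "\<bar>z - (x + k * h)\<bar> < d"
        using z lt h(1,2) by simp_all
      then have "\<bar>g (x + k * h) - g z\<bar> < \<epsilon> / \<eta>"
        using d(2) by (metis abs_minus_commute)
      moreover have "h * g (x + k * h) - (F (x + Suc k * h) - F (x + k * h)) = h * (g (x + k * h) - g z)"
        using z by (simp add: algebra_simps)
      ultimately show "norm (h * g (x + k * h) - (F (x + Suc k * h) - F (x + k * h))) \<le> h * (\<epsilon> / \<eta>)"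
        using h by (simp only: real_norm_def abs_mult abs_of_pos) (intro mult_left_mono, auto)
    qed
    also have "\<dots> = \<epsilon>"
      using \<open>N > 0\<close> \<open>\<eta> > 0\<close> by (simp add: h_def)
    finally show ?thesis .
  qed
  ultimately show "\<exists>f\<in>G. \<forall>x. norm x \<le> B \<longrightarrow> norm (f x - (F (x + \<eta>) - F x)) \<le> \<epsilon>"
    by (intro bexI[of _ ?S] allI impI)
qed

text \<open>Zooming in at \<open>p\<close>: the symmetric second difference of \<open>q\<close> with
  step \<open>h * x\<close>, divided by \<open>h\<^sup>2 * D\<close>, tends to
  \<open>x\<^sup>2\<close> locally uniformly as \<open>h\<close> tends to 0.\<close>

lemma square_if_second_derivative:
  assumes g: "q \<in> G" and q: "\<And>x. (q has_real_derivative q' x) (at x)"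
    and q': "(q' has_real_derivative D) (at p)" and "D \<noteq> 0"
  shows "(\<lambda>x. x\<^sup>2) \<in> G"
proof (rule locally_uniformly_closedD[OF closed])
  show "continuous_on UNIV (\<lambda>x::real. x\<^sup>2)"
    by (intro continuous_intros)
  fix B \<epsilon> :: real
  assume "\<epsilon> > 0"
  define C where "C = max B 1"
  have C: "C > 0" "B \<le> C"
    by (auto simp: C_def)
  \<comment> \<open>Two Taylor errors of size \<open>e * (h * x)\<^sup>2\<close>, divided by
    \<open>h\<^sup>2 * \<bar>D\<bar>\<close>, then total at most \<epsilon>.\<close>
  define e where "e = \<epsilon> * \<bar>D\<bar> / (2 * C\<^sup>2)"
  have "e > 0"
    using \<open>\<epsilon> > 0\<close> \<open>D \<noteq> 0\<close> C by (simp add: e_def)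
  from second_order_Taylor_bound[OF q q' this] obtain \<delta> where \<delta>: "\<delta> > 0"
    "\<And>y. \<bar>y\<bar> < \<delta> \<Longrightarrow> \<bar>q (p + y) - q p - q' p * y - D * y\<^sup>2 / 2\<bar> \<le> e * y\<^sup>2"
    by blast
  define h where "h = \<delta> / (2 * C)"
  have h: "h > 0" "h * C < \<delta>"
    using \<delta> C by (auto simp: h_def field_simps)
  \<comment> \<open>The constant \<open>q p\<close> enters as a dilation by the factor 0.\<close>
  let ?S = "\<lambda>x. 1 / (h\<^sup>2 * D) * (q (h * x + p) + (q (- h * x + p) + - 2 * q (0 * x + p)))"
  have "?S \<in> G"
    by (intro add scale dilate g)
  moreover have "norm (?S x - x\<^sup>2) \<le> \<epsilon>" if "norm x \<le> B" for x
  proof -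
    have x: "\<bar>x\<bar> \<le> C"
      using that C by simp
    then have "\<bar>h * x\<bar> < \<delta>"
      using h by (simp add: abs_mult) (metis less_eq_real_def mult_left_mono order_le_less_trans)
    then have 1: "\<bar>q (p + h * x) - q p - q' p * (h * x) - D * (h * x)\<^sup>2 / 2\<bar> \<le> e * (h * x)\<^sup>2"
      and 2: "\<bar>q (p + - (h * x)) - q p - q' p * (- (h * x)) - D * (- (h * x))\<^sup>2 / 2\<bar> \<le> e * (- (h * x))\<^sup>2"
      using \<delta>(2)[of "h * x"] \<delta>(2)[of "- (h * x)"] by simp_all
    have "?S x - x\<^sup>2 = (q (p + h * x) + q (p + - (h * x)) - 2 * q p - D * (h * x)\<^sup>2) / (h\<^sup>2 * D)"
      using h \<open>D \<noteq> 0\<close> by (simp add: field_simps add.commute)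
    also have "norm \<dots> \<le> (2 * e * (h * x)\<^sup>2) / (h\<^sup>2 * \<bar>D\<bar>)"
      unfolding real_norm_def abs_divide
    proof (rule frac_le)
      show "\<bar>q (p + h * x) + q (p + - (h * x)) - 2 * q p - D * (h * x)\<^sup>2\<bar> \<le> 2 * e * (h * x)\<^sup>2"
        using 1 2 unfolding abs_le_iff by (simp only: power2_minus) (simp add: field_simps)
    qed (use h \<open>D \<noteq> 0\<close> \<open>e > 0\<close> in \<open>auto simp: abs_mult\<close>)
    also have "\<dots> = \<epsilon> * (x\<^sup>2 / C\<^sup>2)"
      using h \<open>D \<noteq> 0\<close> C by (simp add: e_def power_mult_distrib)
    also have "\<dots> \<le> \<epsilon> * 1"
      using \<open>\<epsilon> > 0\<close> C power_mono[OF x, of 2] by (intro mult_left_mono) (simp_all only: power2_abs, simp_all)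
    finally show ?thesis
      by simp
  qed
  ultimately show "\<exists>f\<in>G. \<forall>x. norm x \<le> B \<longrightarrow> norm (f x - x\<^sup>2) \<le> \<epsilon>"
    by (intro bexI[of _ ?S] allI impI)
qed

text \<open>Take a nonzero second difference of \<open>\<rho>\<close> with step \<eta>. The second
  difference of a double antiderivative with the same step lies in \<open>G\<close>, and its second
  derivative is the second difference of \<open>\<rho>\<close>, which does not vanish at
  \<open>x0\<close>.\<close>

lemma square_mem:
  assumes "\<rho> \<in> G" "\<not> affine_fun \<rho>"
  shows "(\<lambda>x. x\<^sup>2) \<in> G"
proof -
  have "\<exists>x \<eta>. \<eta> > 0 \<and> \<rho> (x + 2 * \<eta>) - 2 * \<rho> (x + \<eta>) + \<rho> x \<noteq> 0"
  proof (rule ccontr)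
    assume *: "\<not> ?thesis"
    have "\<rho> (x + 2 * \<eta>) - 2 * \<rho> (x + \<eta>) + \<rho> x = 0" for x \<eta>
    proof (cases "\<eta>" "0::real" rule: linorder_cases)
      case less
      \<comment> \<open>A negative step reads the same three points from the other end.\<close>
      then have "\<rho> (x + 2 * \<eta> + 2 * (- \<eta>)) - 2 * \<rho> (x + 2 * \<eta> + - \<eta>) + \<rho> (x + 2 * \<eta>) = 0"
        using * by (metis neg_0_less_iff_less)
      then show ?thesis
        by (simp add: algebra_simps)
    qed (use * in auto)
    then show False
      using affine_fun_if_second_difference_zero assms cont by blast
  qed
  then obtain x0 \<eta> where \<eta>: "\<eta> > 0" and D: "\<rho> (x0 + 2 * \<eta>) - 2 * \<rho> (x0 + \<eta>) + \<rho> x0 \<noteq> 0"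
    by blast
  obtain F1 where F1: "\<And>x. (F1 has_real_derivative \<rho> x) (at x)"
    using continuous_real_antiderivative[OF cont[OF assms(1)]] by metis
  then have "continuous_on UNIV F1"
    by (meson DERIV_continuous continuous_at_imp_continuous_on)
  then obtain F2 where F2: "\<And>x. (F2 has_real_derivative F1 x) (at x)"
    using continuous_real_antiderivative by blast
  note [derivative_intros] = DERIV_chain2[OF F1] DERIV_chain2[OF F2]
  have G1: "(\<lambda>x. F1 (x + \<eta>) - F1 x) \<in> G"
    using antiderivative_difference[OF assms(1) F1 \<eta>] .
  have "(\<lambda>x. (F2 (x + \<eta> + \<eta>) - F2 (x + \<eta>)) - (F2 (x + \<eta>) - F2 x)) \<in> G"
    by (rule antiderivative_difference[OF G1 _ \<eta>]) (auto intro!: derivative_eq_intros)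
  then show ?thesis
    by (rule square_if_second_derivative[where p = x0 and
          q' = "\<lambda>x. (F1 (x + \<eta> + \<eta>) - F1 (x + \<eta>)) - (F1 (x + \<eta>) - F1 x)", OF _ _ _ D])
      (auto intro!: derivative_eq_intros simp: algebra_simps)
qed

end

section \<open>Composing Euler steps\<close>

lemma abs_exp_minus_le:
  fixes x :: real
  assumes "\<bar>x\<bar> \<le> 1"
  shows "\<bar>exp x - 1 - x\<bar> \<le> x\<^sup>2"
proof -
  have "1 + x \<le> exp x"
    by simp
  moreover have "exp x \<le> 1 + x + x\<^sup>2"
  proof (cases "x \<ge> 0")
    case True
    then show ?thesis
      using exp_bound assms by simp
  next
    case False
    \<comment> \<open>For negative \<open>x\<close> this product is at least 1; replacing
      \<open>1 - x\<close> by the larger \<open>exp (- x)\<close> and multiplying by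
      \<open>exp x\<close> gives the bound.\<close>
    have "(1 + x + x\<^sup>2) * (1 - x) = 1 - x * x\<^sup>2"
      by (simp add: algebra_simps power2_eq_square)
    moreover have "x * x\<^sup>2 \<le> 0"
      using False by (simp add: mult_nonpos_nonneg)
    ultimately have "1 \<le> (1 + x + x\<^sup>2) * (1 - x)"
      by simp
    also have "\<dots> \<le> (1 + x + x\<^sup>2) * exp (- x)"
      using exp_ge_add_one_self[of "- x"] assms
      by (intro mult_left_mono) (auto simp: abs_le_iff intro: add_nonneg_nonneg)
    finally show ?thesis
      by (simp add: exp_minus field_simps)
  qed
  ultimately show ?thesis
    unfolding abs_le_iff by (smt (verit) zero_le_power2)
qed

text \<open>A pair stands for \<open>(l, s)\<close>: the first entry is a frozen parameter, the
  second is the register being updated. Hence composition passes \<open>fst x\<close> on unchanged,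
  and \<open>snd\<close> is the update that does nothing.\<close>

locale update_semigroup =
  fixes U :: "(real \<times> real \<Rightarrow> real) set" and \<rho> :: "real \<Rightarrow> real"
  assumes U_comp: "u \<in> U \<Longrightarrow> v \<in> U \<Longrightarrow> (\<lambda>x. v (fst x, u x)) \<in> U"
    and U_snd: "snd \<in> U"
    and U_neuron: "(\<lambda>x. snd x + h * \<rho> (a * snd x + b * fst x + c)) \<in> U"
    and U_closed: "locally_uniformly_closed U"
    and cont_\<rho>: "continuous_on UNIV \<rho>"
begin

text \<open>Velocity fields of the second coordinate whose Euler steps are, up to \<open>o(h)\<close>, updates in \<open>U\<close>.\<close>

definition fields :: "(real \<times> real \<Rightarrow> real) set" where
  "fields = {v. continuous_on UNIV v \<and>
     (\<forall>B. \<forall>\<epsilon>>0. \<exists>h0>0. \<forall>h. \<bar>h\<bar> < h0 \<longrightarrow>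
        (\<exists>u\<in>U. \<forall>x. norm x \<le> B \<longrightarrow> \<bar>u x - snd x - h * v x\<bar> \<le> \<bar>h\<bar> * \<epsilon>))}"

lemma fieldsE:
  assumes "v \<in> fields" "\<epsilon> > 0"
  obtains h0 where "h0 > 0" "\<And>h. \<bar>h\<bar> < h0 \<Longrightarrow>
        \<exists>u\<in>U. \<forall>x. norm x \<le> B \<longrightarrow> \<bar>u x - snd x - h * v x\<bar> \<le> \<bar>h\<bar> * \<epsilon>"
  using assms unfolding fields_def by blast

lemma fieldsI:
  assumes "continuous_on UNIV v"
    and "\<And>B \<epsilon>. \<epsilon> > 0 \<Longrightarrow> \<exists>h0>0. \<forall>h. \<bar>h\<bar> < h0 \<longrightarrow>
        (\<exists>u\<in>U. \<forall>x. norm x \<le> B \<longrightarrow> \<bar>u x - snd x - h * v x\<bar> \<le> \<bar>h\<bar> * \<epsilon>)"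
  shows "v \<in> fields"
  using assms unfolding fields_def by blast

lemma fields_cont: "v \<in> fields \<Longrightarrow> continuous_on UNIV v"
  by (simp add: fields_def)

lemma fields_neuron: "(\<lambda>x. \<rho> (a * snd x + b * fst x + c)) \<in> fields"
proof (rule fieldsI)
  show "continuous_on UNIV (\<lambda>x. \<rho> (a * snd x + b * fst x + c))"
    by (rule continuous_on_compose2[OF cont_\<rho>]) (auto intro!: continuous_intros)
  fix B \<epsilon> :: real
  assume "\<epsilon> > 0"
  have "\<forall>x. norm x \<le> B \<longrightarrow> \<bar>(snd x + h * \<rho> (a * snd x + b * fst x + c)) - snd x
      - h * \<rho> (a * snd x + b * fst x + c)\<bar> \<le> \<bar>h\<bar> * \<epsilon>" for h
    using \<open>\<epsilon> > 0\<close> by simp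
  then show "\<exists>h0>0. \<forall>h. \<bar>h\<bar> < h0 \<longrightarrow> (\<exists>u\<in>U. \<forall>x. norm x \<le> B \<longrightarrow>
      \<bar>u x - snd x - h * \<rho> (a * snd x + b * fst x + c)\<bar> \<le> \<bar>h\<bar> * \<epsilon>)"
    using U_neuron zero_less_one by (metis (no_types, lifting))
qed

text \<open>A step of length \<open>h\<close> along \<open>a * v\<close> is a step of length
  \<open>h * a\<close> along \<open>v\<close>. Since \<open>fields\<close> admits steps of both
  signs, \<open>a\<close> may be negative.\<close>

lemma fields_scale:
  assumes "v \<in> fields"
  shows "(\<lambda>x. a * v x) \<in> fields"
proof (rule fieldsI)
  show "continuous_on UNIV (\<lambda>x. a * v x)"
    by (intro continuous_intros fields_cont assms)
  fix B \<epsilon> :: real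
  assume "\<epsilon> > 0"
  \<comment> \<open>The added 1 allows division by \<open>C\<close> even for a = 0.\<close>
  define C where "C = \<bar>a\<bar> + 1"
  have C: "C > 0" "\<bar>a\<bar> \<le> C"
    by (auto simp: C_def)
  then obtain h0 where h0: "h0 > 0" "\<And>h. \<bar>h\<bar> < h0 \<Longrightarrow>
        \<exists>u\<in>U. \<forall>x. norm x \<le> B \<longrightarrow> \<bar>u x - snd x - h * v x\<bar> \<le> \<bar>h\<bar> * (\<epsilon> / C)"
    using fieldsE[OF assms, of "\<epsilon> / C" B] \<open>\<epsilon> > 0\<close> by (metis divide_pos_pos)
  show "\<exists>h0>0. \<forall>h. \<bar>h\<bar> < h0 \<longrightarrow>
        (\<exists>u\<in>U. \<forall>x. norm x \<le> B \<longrightarrow> \<bar>u x - snd x - h * (a * v x)\<bar> \<le> \<bar>h\<bar> * \<epsilon>)"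
  proof (intro exI[of _ "h0 / C"] conjI allI impI)
    fix h :: real
    assume "\<bar>h\<bar> < h0 / C"
    then have "\<bar>h\<bar> * C < h0"
      using C by (simp add: field_simps)
    moreover have le: "\<bar>h * a\<bar> \<le> \<bar>h\<bar> * C"
      using C by (simp add: abs_mult mult_left_mono)
    ultimately obtain u where u: "u \<in> U"
      "\<forall>x. norm x \<le> B \<longrightarrow> \<bar>u x - snd x - h * a * v x\<bar> \<le> \<bar>h * a\<bar> * (\<epsilon> / C)"
      using h0(2)[of "h * a"] by auto
    have "\<bar>h * a\<bar> * (\<epsilon> / C) \<le> \<bar>h\<bar> * C * (\<epsilon> / C)"
      using le \<open>\<epsilon> > 0\<close> C by (intro mult_right_mono) auto
    also have "\<dots> = \<bar>h\<bar> * \<epsilon>"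
      using C by simp
    finally show "\<exists>u\<in>U. \<forall>x. norm x \<le> B \<longrightarrow> \<bar>u x - snd x - h * (a * v x)\<bar> \<le> \<bar>h\<bar> * \<epsilon>"
      using u by (intro bexI[OF _ u(1)]) (auto simp: mult.assoc intro: order_trans)
  qed (use h0 C in auto)
qed

text \<open>Step along \<open>v\<close>, then along \<open>w\<close>. The second step starts at a
  displaced point, but the displacement is O(h), so by uniform continuity \<open>w\<close> changes
  there by o(1), which costs o(h).\<close>

lemma fields_add:
  assumes v: "v \<in> fields" and w: "w \<in> fields"
  shows "(\<lambda>x. v x + w x) \<in> fields"
proof (rule fieldsI)
  show "continuous_on UNIV (\<lambda>x. v x + w x)"
    by (intro continuous_intros fields_cont v w)
  fix B \<epsilon> :: real
  assume "\<epsilon> > 0"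
  then have \<epsilon>3: "\<epsilon> / 3 > 0"
    by simp
  from fieldsE[OF v \<epsilon>3] obtain h1 where h1: "h1 > 0" "\<And>h. \<bar>h\<bar> < h1 \<Longrightarrow>
      \<exists>u\<in>U. \<forall>x. norm x \<le> B \<longrightarrow> \<bar>u x - snd x - h * v x\<bar> \<le> \<bar>h\<bar> * (\<epsilon> / 3)"
    by blast
  from fieldsE[OF w \<epsilon>3] obtain h2 where h2: "h2 > 0" "\<And>h. \<bar>h\<bar> < h2 \<Longrightarrow>
      \<exists>u\<in>U. \<forall>x. norm x \<le> B + 1 \<longrightarrow> \<bar>u x - snd x - h * w x\<bar> \<le> \<bar>h\<bar> * (\<epsilon> / 3)"
    by blast
  have "bounded (v ` cball 0 B)"
    by (intro compact_imp_bounded compact_continuous_image continuous_on_subset[OF fields_cont[OF v]]) auto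
  then obtain M where M: "M > 0" "\<And>x. norm x \<le> B \<Longrightarrow> \<bar>v x\<bar> \<le> M"
    unfolding bounded_pos by auto
  have "uniformly_continuous_on (cball 0 (B + 1)) w"
    by (intro compact_uniformly_continuous continuous_on_subset[OF fields_cont[OF w]]) auto
  then obtain \<delta> where "\<delta> > 0"
    "\<forall>x\<in>cball 0 (B + 1). \<forall>y\<in>cball 0 (B + 1). dist y x < \<delta> \<longrightarrow> dist (w y) (w x) < \<epsilon> / 3"
    using \<epsilon>3 unfolding uniformly_continuous_on_def by blast
  then have \<delta>: "\<delta> > 0" "\<And>x y. norm x \<le> B + 1 \<Longrightarrow> norm y \<le> B + 1 \<Longrightarrow> norm (y - x) < \<delta> \<Longrightarrow>
      \<bar>w y - w x\<bar> < \<epsilon> / 3"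
    unfolding Ball_def dist_norm mem_cball_0 real_norm_def by blast+
  define L where "L = M + \<epsilon> / 3"
  have "L > 0"
    using M \<epsilon>3 by (simp add: L_def)
  show "\<exists>h0>0. \<forall>h. \<bar>h\<bar> < h0 \<longrightarrow>
        (\<exists>u\<in>U. \<forall>x. norm x \<le> B \<longrightarrow> \<bar>u x - snd x - h * (v x + w x)\<bar> \<le> \<bar>h\<bar> * \<epsilon>)"
  \<comment> \<open>\<open>L\<close> bounds the speed of the first step. The first two entries make
    each step accurate, the third keeps the displacement below \<delta>, and the last keeps the
    displaced point in the ball of radius \<open>B + 1\<close>.\<close>
  proof (intro exI[of _ "Min {h1, h2, \<delta> / L, 1 / L}"] conjI allI impI)
    fix h :: real
    assume "\<bar>h\<bar> < Min {h1, h2, \<delta> / L, 1 / L}"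
    then have h: "\<bar>h\<bar> < h1" "\<bar>h\<bar> < h2" "\<bar>h\<bar> * L < \<delta>" "\<bar>h\<bar> * L < 1"
      using \<open>L > 0\<close> by (auto simp: field_simps)
    obtain u1 where u1: "u1 \<in> U"
      "\<And>x. norm x \<le> B \<Longrightarrow> \<bar>u1 x - snd x - h * v x\<bar> \<le> \<bar>h\<bar> * (\<epsilon> / 3)"
      using h1(2)[OF h(1)] by blast
    obtain u2 where u2: "u2 \<in> U"
      "\<And>x. norm x \<le> B + 1 \<Longrightarrow> \<bar>u2 x - snd x - h * w x\<bar> \<le> \<bar>h\<bar> * (\<epsilon> / 3)"
      using h2(2)[OF h(2)] by blast
    have "\<bar>u2 (fst x, u1 x) - snd x - h * (v x + w x)\<bar> \<le> \<bar>h\<bar> * \<epsilon>" if x: "norm x \<le> B" for x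
    proof -
      define y where "y = (fst x, u1 x)"
      have "y - x = (0, u1 x - snd x)"
        by (simp add: y_def prod_eq_iff)
      then have "norm (y - x) = \<bar>u1 x - snd x\<bar>"
        by (simp add: norm_Pair)
      also have "\<dots> \<le> \<bar>h\<bar> * (\<epsilon> / 3) + \<bar>h * v x\<bar>"
        using u1(2)[OF x] by linarith
      also have "\<dots> \<le> \<bar>h\<bar> * (\<epsilon> / 3) + \<bar>h\<bar> * M"
        using M(2)[OF x] by (simp add: abs_mult mult_left_mono)
      also have "\<dots> = \<bar>h\<bar> * L"
        by (simp add: L_def ring_distribs)
      finally have yx: "norm (y - x) \<le> \<bar>h\<bar> * L" .
      have y: "norm y \<le> B + 1"
        using norm_triangle_ineq[of x "y - x"] yx h x by simp
      have "\<bar>w y - w x\<bar> \<le> \<epsilon> / 3"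
        using \<delta>(2)[OF _ y, of x] yx h x by simp
      then have "\<bar>h * (w y - w x)\<bar> \<le> \<bar>h\<bar> * (\<epsilon> / 3)"
        by (simp add: abs_mult mult_left_mono del: times_divide_eq_right)
      moreover have "u2 y - snd x - h * (v x + w x) =
          (u2 y - snd y - h * w y) + (u1 x - snd x - h * v x) + h * (w y - w x)"
        by (simp add: y_def algebra_simps)
      ultimately show ?thesis
        using u1(2)[OF x] u2(2)[OF y] unfolding y_def[symmetric] by linarith
    qed
    then show "\<exists>u\<in>U. \<forall>x. norm x \<le> B \<longrightarrow> \<bar>u x - snd x - h * (v x + w x)\<bar> \<le> \<bar>h\<bar> * \<epsilon>"
      by (intro bexI[OF _ U_comp[OF u1(1) u2(1)]]) blast
  qed (use h1 h2 \<delta> \<open>L > 0\<close> in auto)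
qed

lemma fields_closed: "locally_uniformly_closed fields"
  unfolding locally_uniformly_closed_def
proof (intro allI impI fieldsI)
  fix v :: "real \<times> real \<Rightarrow> real" and B \<epsilon> :: real
  assume "\<forall>B. \<forall>\<epsilon>>0. \<exists>g\<in>fields. \<forall>x. norm x \<le> B \<longrightarrow> norm (g x - v x) \<le> \<epsilon>" and "\<epsilon> > 0"
  then obtain g where g: "g \<in> fields" "\<And>x. norm x \<le> B \<Longrightarrow> \<bar>g x - v x\<bar> \<le> \<epsilon> / 2"
    by (metis half_gt_zero real_norm_def)
  obtain h0 where h0: "h0 > 0" "\<And>h. \<bar>h\<bar> < h0 \<Longrightarrow>
      \<exists>u\<in>U. \<forall>x. norm x \<le> B \<longrightarrow> \<bar>u x - snd x - h * g x\<bar> \<le> \<bar>h\<bar> * (\<epsilon> / 2)"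
    using fieldsE[OF g(1), of "\<epsilon> / 2" B] \<open>\<epsilon> > 0\<close> by auto
  have *: "\<bar>t - h * v x\<bar> \<le> \<bar>h\<bar> * \<epsilon>"
    if "\<bar>t - h * g x\<bar> \<le> \<bar>h\<bar> * (\<epsilon> / 2)" "norm x \<le> B" for t h x
  proof -
    have "\<bar>h * (g x - v x)\<bar> \<le> \<bar>h\<bar> * (\<epsilon> / 2)"
      using g(2)[OF that(2)] by (simp add: abs_mult mult_left_mono del: times_divide_eq_right)
    then show ?thesis
      using that(1) unfolding right_diff_distrib by linarith
  qed
  show "\<exists>h0>0. \<forall>h. \<bar>h\<bar> < h0 \<longrightarrow>
      (\<exists>u\<in>U. \<forall>x. norm x \<le> B \<longrightarrow> \<bar>u x - snd x - h * v x\<bar> \<le> \<bar>h\<bar> * \<epsilon>)"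
    using h0 * by (intro exI[of _ h0] conjI) blast+
qed

text \<open>The profiles \<open>g\<close> for which every
  \<open>g (a * snd x + b * fst x + c)\<close> is a field form a closed dilation-invariant space. It
  contains the non-affine \<open>\<rho>\<close>, hence the square.\<close>

lemma fields_square:
  assumes "\<not> affine_fun \<rho>"
  shows "(\<lambda>x. (a * snd x + b * fst x + c)\<^sup>2) \<in> fields"
proof -
  interpret dilation_invariant_space
    "{g. continuous_on UNIV g \<and> (\<forall>a b c. (\<lambda>x. g (a * snd x + b * fst x + c)) \<in> fields)}"
  proof
    show "(\<lambda>x. g (p * x + q)) \<in>
        {g. continuous_on UNIV g \<and> (\<forall>a b c. (\<lambda>x. g (a * snd x + b * fst x + c)) \<in> fields)}"
      if "g \<in> {g. continuous_on UNIV g \<and> (\<forall>a b c. (\<lambda>x. g (a * snd x + b * fst x + c)) \<in> fields)}"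
      for g p q
    proof -
      have "(\<lambda>x. g (p * (a * snd x + b * fst x + c) + q)) \<in> fields" for a b c
      proof -
        have "(\<lambda>x. g ((p * a) * snd x + (p * b) * fst x + (p * c + q))) \<in> fields"
          using that by blast
        then show ?thesis
          by (simp add: algebra_simps)
      qed
      moreover have "continuous_on UNIV (\<lambda>x. g (p * x + q))"
        using that by (intro continuous_on_compose2[of UNIV g UNIV "\<lambda>x. p * x + q"] continuous_intros) auto
      ultimately show ?thesis
        by blast
    qed
    show "locally_uniformly_closed
        {g. continuous_on UNIV g \<and> (\<forall>a b c. (\<lambda>x. g (a * snd x + b * fst x + c)) \<in> fields)}"
      unfolding locally_uniformly_closed_def
    proof (intro allI impI CollectI conjI)
      fix f :: "real \<Rightarrow> real" and a b c
      assume f: "continuous_on UNIV f"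
        and approx: "\<forall>B. \<forall>\<epsilon>>0. \<exists>g\<in>{g. continuous_on UNIV g \<and>
          (\<forall>a b c. (\<lambda>x. g (a * snd x + b * fst x + c)) \<in> fields)}.
          \<forall>x. norm x \<le> B \<longrightarrow> norm (g x - f x) \<le> \<epsilon>"
      show "(\<lambda>x. f (a * snd x + b * fst x + c)) \<in> fields"
      proof (rule locally_uniformly_closedD[OF fields_closed])
        show "continuous_on UNIV (\<lambda>x. f (a * snd x + b * fst x + c))"
          by (rule continuous_on_compose2[OF f]) (auto intro!: continuous_intros)
        fix B \<epsilon> :: real
        assume "\<epsilon> > 0"
        define R where "R = \<bar>a\<bar> * B + \<bar>b\<bar> * B + \<bar>c\<bar>"
        have R: "norm (a * snd x + b * fst x + c) \<le> R" if "norm x \<le> B" for x :: "real \<times> real"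
        proof -
          have "\<bar>snd x\<bar> \<le> B" "\<bar>fst x\<bar> \<le> B"
            using that norm_fst_le[of "fst x" "snd x"] norm_snd_le[of "snd x" "fst x"] by auto
          then have "\<bar>a * snd x\<bar> \<le> \<bar>a\<bar> * B" "\<bar>b * fst x\<bar> \<le> \<bar>b\<bar> * B"
            by (auto simp: abs_mult mult_left_mono)
          then show ?thesis
            unfolding R_def real_norm_def by linarith
        qed
        obtain g where "\<forall>a b c. (\<lambda>x. g (a * snd x + b * fst x + c)) \<in> fields"
          "\<forall>x. norm x \<le> R \<longrightarrow> norm (g x - f x) \<le> \<epsilon>"
          using approx \<open>\<epsilon> > 0\<close> by blast
        with R show "\<exists>g\<in>fields. \<forall>x. norm x \<le> B \<longrightarrow>
            norm (g x - f (a * snd x + b * fst x + c)) \<le> \<epsilon>"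
          by (intro bexI[of _ "\<lambda>x. g (a * snd x + b * fst x + c)"]) auto
      qed
    qed
  qed (auto intro!: continuous_intros fields_add fields_scale)
  show ?thesis
    using square_mem[OF _ assms] fields_neuron cont_\<rho> by blast
qed

lemma fields_product:
  assumes "\<not> affine_fun \<rho>"
  shows "(\<lambda>x. fst x * snd x) \<in> fields"
proof -
  have "(\<lambda>x. 1 / 4 * (1 * snd x + 1 * fst x + 0)\<^sup>2 + - 1 / 4 * (1 * snd x + - 1 * fst x + 0)\<^sup>2) \<in> fields"
    by (intro fields_add fields_scale fields_square assms)
  then show ?thesis
    by (simp add: power2_eq_square algebra_simps)
qed

text \<open>Euler's method for \<open>ds/d\<tau> = l s\<close> over unit time.\<close>

lemma exponential_update:
  assumes "\<not> affine_fun \<rho>"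
  shows "(\<lambda>x. snd x * exp (fst x)) \<in> U"
proof (rule locally_uniformly_closedD[OF U_closed])
  show "continuous_on UNIV (\<lambda>x :: real \<times> real. snd x * exp (fst x))"
    by (intro continuous_intros)
  fix B0 \<epsilon> :: real
  assume "\<epsilon> > 0"
  define B where "B = max B0 1"
  have B: "B \<ge> 1" "B0 \<le> B"
    by (auto simp: B_def)
  \<comment> \<open>The exact flow stays within \<open>B * exp B\<close> up to time 1; the extra 1
    leaves room for the accumulated error of the iterates.\<close>
  define C where "C = B * exp B + 1"
  have C: "C \<ge> 1"
    using B by (simp add: C_def)
  \<comment> \<open>The global error will be at most \<open>e * exp B\<close>, which must not exceed
    \<epsilon>, nor the margin 1 contained in \<open>C\<close>.\<close>
  define e where "e = min \<epsilon> 1 / exp B"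
  have e: "e > 0" "e * exp B \<le> \<epsilon>" "e * exp B \<le> 1"
    using \<open>\<epsilon> > 0\<close> by (auto simp: e_def)
  obtain h0 where h0: "h0 > 0" "\<And>h. \<bar>h\<bar> < h0 \<Longrightarrow> \<exists>u\<in>U. \<forall>x. norm x \<le> B + C \<longrightarrow>
      \<bar>u x - snd x - h * (fst x * snd x)\<bar> \<le> \<bar>h\<bar> * (e / 2)"
    using fieldsE[OF fields_product[OF assms], of "e / 2" "B + C"] e(1) by auto
  \<comment> \<open>The three entries give, for h = 1 / N, a step that \<open>u\<close> can realise,
    an exponent \<open>h * l\<close> of modulus at most 1, and a second-order error of at most
    \<open>h * (e / 2)\<close>.\<close>
  obtain N :: nat where N: "N > Max {1 / h0, B, 2 * C * B\<^sup>2 / e}"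
    using reals_Archimedean2 by blast
  then have N': "1 / h0 < N" "B < N" "2 * C * B\<^sup>2 / e < N"
    by auto
  define h where "h = 1 / real N"
  have "N > 0"
    using N'(2) B by simp
  have h: "h > 0" "h < h0" "h * B \<le> 1" "h * (C * B\<^sup>2) \<le> e / 2"
    using N' \<open>N > 0\<close> h0(1) e(1) by (auto simp: h_def field_simps)
  obtain u where u: "u \<in> U" "\<And>x. norm x \<le> B + C \<Longrightarrow>
      \<bar>u x - snd x - h * (fst x * snd x)\<bar> \<le> h * (e / 2)"
    using h0(2)[of h] h by auto
  \<comment> \<open>Local error: one half comes from \<open>u\<close> against the Euler step, the
    other from the Euler step against the exact flow.\<close>
  have step: "\<bar>u (l, s) - s * exp (h * l)\<bar> \<le> h * e" if "\<bar>l\<bar> \<le> B" "\<bar>s\<bar> \<le> C" for l s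
  proof -
    have "norm (l, s) \<le> B + C"
      using norm_Pair_le[of l s] that by simp
    then have 1: "\<bar>u (l, s) - s - h * (l * s)\<bar> \<le> h * (e / 2)"
      using u(2) by fastforce
    have hl: "\<bar>h * l\<bar> \<le> h * B"
      using that h by (simp add: abs_mult)
    then have "\<bar>exp (h * l) - 1 - h * l\<bar> \<le> (h * l)\<^sup>2"
      using h by (intro abs_exp_minus_le) simp
    also have "\<dots> \<le> (h * B)\<^sup>2"
      using power_mono[OF hl, of 2] by simp
    finally have "\<bar>s\<bar> * \<bar>exp (h * l) - 1 - h * l\<bar> \<le> C * (h * B)\<^sup>2"
      using that C by (intro mult_mono) auto
    also have "\<dots> = h * (h * (C * B\<^sup>2))"
      by (simp add: power2_eq_square)
    also have "\<dots> \<le> h * (e / 2)"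
      using h by (intro mult_left_mono) auto
    finally have "\<bar>s * (exp (h * l) - 1 - h * l)\<bar> \<le> h * (e / 2)"
      by (simp add: abs_mult)
    moreover have "s * (exp (h * l) - 1 - h * l) = s * exp (h * l) - s - h * (l * s)"
      by (simp add: algebra_simps)
    moreover have "h * (e / 2) + h * (e / 2) = h * e"
      by simp
    ultimately show ?thesis
      using 1 by linarith
  qed
  define w where "w = rec_nat (snd :: real \<times> real \<Rightarrow> real) (\<lambda>_ f x. u (fst x, f x))"
  have w: "w 0 = snd" "w (Suc k) = (\<lambda>x. u (fst x, w k x))" for k
    by (simp_all add: w_def)
  have "w k \<in> U" for k
    by (induction k) (simp_all add: w U_snd U_comp u(1))
  moreover have "norm (w N x - snd x * exp (fst x)) \<le> \<epsilon>" if x: "norm x \<le> B0" for x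
  proof -
    obtain l s where [simp]: "x = (l, s)"
      by (cases x)
    have l: "\<bar>l\<bar> \<le> B" and s: "\<bar>s\<bar> \<le> B"
      using x B norm_fst_le[of l s] norm_snd_le[of s l] by auto
    \<comment> \<open>Discrete Gronwall estimate: each step multiplies the old error by at most
      \<open>exp (B * h)\<close> and adds at most \<open>h * e\<close>.\<close>
    have bound: "\<bar>w k (l, s) - s * exp (k * h * l)\<bar> \<le> k * h * e * exp (B * (k * h))" if "k \<le> N" for k
      using that
    proof (induction k)
      case 0
      then show ?case
        by (simp add: w)
    next
      case (Suc k)
      let ?w = "w k (l, s)"
      have IH: "\<bar>?w - s * exp (k * h * l)\<bar> \<le> k * h * e * exp (B * (k * h))"
        using Suc by simp
      have kh: "0 \<le> k * h" "k * h \<le> 1"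
        using Suc.prems \<open>N > 0\<close> by (auto simp: h_def field_simps)
      have "k * h * e * exp (B * (k * h)) \<le> 1 * e * exp (B * 1)"
        using kh e B by (intro mult_mono) auto
      then have "\<bar>?w - s * exp (k * h * l)\<bar> \<le> 1"
        using IH e(3) unfolding mult_1 mult_1_right by linarith
      moreover have "\<bar>s * exp (k * h * l)\<bar> \<le> B * exp B"
      proof -
        have "k * h * l \<le> k * h * B"
          using kh l by (intro mult_left_mono) auto
        also have "\<dots> \<le> 1 * B"
          using kh B by (intro mult_right_mono) auto
        finally show ?thesis
          using s by (auto simp: abs_mult intro!: mult_mono)
      qed
      ultimately have "\<bar>?w\<bar> \<le> C"
        unfolding C_def by linarith
      then have 1: "\<bar>u (l, ?w) - ?w * exp (h * l)\<bar> \<le> h * e"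
        using step l by blast
      have exp_Suc: "exp (B * (Suc k * h)) = exp (B * (k * h)) * exp (B * h)"
        by (simp add: exp_add[symmetric] ring_distribs)
      have "h * l \<le> B * h"
        using l h by (simp add: mult.commute abs_le_iff)
      then have "\<bar>?w - s * exp (k * h * l)\<bar> * exp (h * l) \<le>
          k * h * e * exp (B * (k * h)) * exp (B * h)"
        using IH kh e by (intro mult_mono) auto
      then have "\<bar>(?w - s * exp (k * h * l)) * exp (h * l)\<bar> \<le> k * h * e * exp (B * (Suc k * h))"
        unfolding exp_Suc by (simp add: abs_mult mult.assoc)
      moreover have "(?w - s * exp (k * h * l)) * exp (h * l) = ?w * exp (h * l) - s * exp (Suc k * h * l)"
        by (simp add: ring_distribs exp_add)
      moreover have "h * e * 1 \<le> h * e * exp (B * (Suc k * h))"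
        using h e B by (intro mult_left_mono) auto
      ultimately have "\<bar>u (l, ?w) - s * exp (Suc k * h * l)\<bar> \<le>
          h * e * exp (B * (Suc k * h)) + k * h * e * exp (B * (Suc k * h))"
        using 1 by linarith
      also have "\<dots> = Suc k * h * e * exp (B * (Suc k * h))"
        by (simp add: ring_distribs)
      finally show ?case
        by (simp add: w)
    qed
    have "N * h = 1"
      using \<open>N > 0\<close> by (simp add: h_def)
    then show ?thesis
      using bound[of N] e by (simp add: mult.commute)
  qed
  ultimately show "\<exists>f\<in>U. \<forall>x. norm x \<le> B0 \<longrightarrow> norm (f x - snd x * exp (fst x)) \<le> \<epsilon>"
    by blast
qed

end

section \<open>Registers and single-neuron layers\<close>

text \<open>Put \<open>x\<close> and \<open>y\<close> into one column of the two factors and zeros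
  elsewhere. An index \<open>k0\<close> exists because types are inhabited, so every rank r \<ge> 1
  is treated alike.\<close>

lemma exists_dlor_rank_one:
  fixes \<alpha> :: real and x y :: "real^'w::finite"
  shows "\<exists>M \<in> dlor_components (R :: 'r::finite itself). \<forall>z. M *v z = \<alpha> *\<^sub>R z + (y \<bullet> z) *\<^sub>R x"
proof
  fix k0 :: 'r
  define U :: "real^'r^'w" where "U = (\<chi> i k. if k = k0 then x $ i else 0)"
  define V :: "real^'r^'w" where "V = (\<chi> i k. if k = k0 then y $ i else 0)"
  have "transpose V *v z = (\<chi> k. if k = k0 then y \<bullet> z else 0)" for z
    by (auto simp: vec_eq_iff matrix_vector_mult_def transpose_def V_def inner_vec_def)
  then have "U *v (transpose V *v z) = (y \<bullet> z) *\<^sub>R x" for z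
    by (auto simp: vec_eq_iff matrix_vector_mult_def U_def if_distrib[where f = "\<lambda>a. a * _"] cong: if_cong)
  then show "\<forall>z. (\<alpha> *\<^sub>R mat 1 + U ** transpose V) *v z = \<alpha> *\<^sub>R z + (y \<bullet> z) *\<^sub>R x"
    by (simp add: matrix_vector_mult_add_rdistrib scaleR_matrix_vector_assoc[symmetric]
        matrix_vector_mul_assoc[symmetric])
  show "\<alpha> *\<^sub>R mat 1 + U ** transpose V \<in> dlor_components R"
    unfolding dlor_components_def by blast
qed

lemma scaleR_dlor:
  fixes M :: "real^'w^'w" and R :: "'r::finite itself"
  assumes "M \<in> dlor_components R"
  shows "s *\<^sub>R M \<in> dlor_components R"
proof -
  obtain \<alpha> and U V :: "real^'r^'w" where "M = \<alpha> *\<^sub>R mat 1 + U ** transpose V"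
    using assms unfolding dlor_components_def by blast
  then have "s *\<^sub>R M = (s * \<alpha>) *\<^sub>R mat 1 + (s *\<^sub>R U) ** transpose V"
    by (simp add: vec_eq_iff matrix_matrix_mult_def sum_distrib_left algebra_simps)
  then show ?thesis
    unfolding dlor_components_def by blast
qed

lemma norm_le_card_mult:
  fixes x :: "real^'w::finite" and e :: real
  assumes "\<And>i. \<bar>x $ i\<bar> \<le> e"
  shows "norm x \<le> CARD('w) * e"
  using order_trans[OF norm_le_l1_cart sum_mono[of UNIV "\<lambda>i. \<bar>x $ i\<bar>" "\<lambda>_. e"]] assms by simp

lemma hidden_layer_nth: "hidden_layer \<rho> (M, b) z $ i = \<rho> ((M *v z + b) $ i)"
  by (simp add: hidden_layer_def)

lemma continuous_on_hidden_layer: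
  assumes "continuous_on UNIV \<rho>"
  shows "continuous_on UNIV (hidden_layer \<rho> L)"
proof (cases L)
  case (Pair M b)
  show ?thesis
    unfolding Pair hidden_layer_def prod.case
    by (intro continuous_on_vec_lambda continuous_on_compose2[OF assms] continuous_intros
        matrix_vector_mult_linear_continuous_on) auto
qed

lemma continuous_on_fold_hidden_layer:
  assumes "continuous_on UNIV \<rho>"
  shows "continuous_on UNIV (fold (hidden_layer \<rho>) Ls)"
proof (induction Ls)
  case (Cons L Ls)
  show ?case
    using continuous_on_compose2[OF Cons continuous_on_hidden_layer[OF assms, of L]]
    by (simp add: comp_def)
qed (simp add: id_def)

lemma axis_one_nth: "axis i 1 $ j = (if j = i then 1 else 0)"
  by (simp add: axis_def)

definition set_coord :: "'w::finite \<Rightarrow> (real^'w \<Rightarrow> real) \<Rightarrow> real^'w \<Rightarrow> real^'w" where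
  "set_coord i f z = (\<chi> j. if j = i then f z else z $ j)"

lemma set_coord_nth: "set_coord i f z $ j = (if j = i then f z else z $ j)"
  by (simp add: set_coord_def)

section \<open>State maps approximable by DLoR networks, and their closure properties\<close>

locale dlor_activation =
  fixes \<rho> :: "real \<Rightarrow> real" and c D :: real and R :: "'r::finite itself"
  assumes cont: "continuous_on UNIV \<rho>"
    and deriv: "(\<rho> has_real_derivative D) (at c)" and D: "D \<noteq> 0"
begin

text \<open>The readout is a scalar multiple plus a shift because a following layer can absorb such
  a map: by \<open>scaleR_dlor\<close> its weight matrix remains a DLoR component of the same
  rank.\<close>

definition approximable :: "(real^'w::finite \<Rightarrow> real^'w) set" where
  "approximable = {F. continuous_on UNIV F \<and> (\<forall>B. \<forall>\<epsilon>>0. \<exists>Ls s d.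
     Ls \<noteq> [] \<and> (\<forall>(M, b) \<in> set Ls. M \<in> dlor_components R) \<and>
     (\<forall>z. norm z \<le> B \<longrightarrow> norm (s *\<^sub>R fold (hidden_layer \<rho>) Ls z + d - F z) \<le> \<epsilon>))}"

lemma approximableI:
  assumes "continuous_on UNIV F"
    and "\<And>B \<epsilon>. \<epsilon> > 0 \<Longrightarrow> \<exists>Ls s d. Ls \<noteq> [] \<and> (\<forall>(M, b) \<in> set Ls. M \<in> dlor_components R) \<and>
     (\<forall>z. norm z \<le> B \<longrightarrow> norm (s *\<^sub>R fold (hidden_layer \<rho>) Ls z + d - F z) \<le> \<epsilon>)"
  shows "F \<in> approximable"
  using assms unfolding approximable_def by blast

lemma approximableE:
  assumes "F \<in> approximable" "\<epsilon> > 0"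
  obtains Ls s d where "Ls \<noteq> []" "\<And>M b. (M, b) \<in> set Ls \<Longrightarrow> M \<in> dlor_components R"
    "\<And>z. norm z \<le> B \<Longrightarrow> norm (s *\<^sub>R fold (hidden_layer \<rho>) Ls z + d - F z) \<le> \<epsilon>"
proof -
  have "\<exists>Ls s d. Ls \<noteq> [] \<and> (\<forall>(M, b) \<in> set Ls. M \<in> dlor_components R) \<and>
     (\<forall>z. norm z \<le> B \<longrightarrow> norm (s *\<^sub>R fold (hidden_layer \<rho>) Ls z + d - F z) \<le> \<epsilon>)"
    using assms unfolding approximable_def by blast
  then obtain Ls s d where *: "Ls \<noteq> []" "\<forall>(M, b) \<in> set Ls. M \<in> dlor_components R"
    "\<forall>z. norm z \<le> B \<longrightarrow> norm (s *\<^sub>R fold (hidden_layer \<rho>) Ls z + d - F z) \<le> \<epsilon>"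
    by blast
  show thesis
    by (rule that[of Ls s d]) (use * in auto)
qed

lemma approximable_cont: "F \<in> approximable \<Longrightarrow> continuous_on UNIV F"
  by (simp add: approximable_def)

lemma approximable_layer:
  assumes "M \<in> dlor_components R"
  shows "hidden_layer \<rho> (M, b) \<in> approximable"
proof (rule approximableI)
  show "continuous_on UNIV (hidden_layer \<rho> (M, b))"
    by (rule continuous_on_hidden_layer[OF cont])
  show "\<exists>Ls s d. Ls \<noteq> [] \<and> (\<forall>(M, b) \<in> set Ls. M \<in> dlor_components R) \<and>
     (\<forall>z. norm z \<le> B \<longrightarrow> norm (s *\<^sub>R fold (hidden_layer \<rho>) Ls z + d - hidden_layer \<rho> (M, b) z) \<le> \<epsilon>)"
    if "\<epsilon> > 0" for B \<epsilon>
    using assms that by (intro exI[of _ "[(M, b)]"] exI[of _ 1] exI[of _ 0]) simp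
qed

text \<open>The affine map \<open>y \<mapsto> s y + d\<close> between two networks is absorbed by the first layer of the second.\<close>

lemma approximable_comp:
  assumes F: "F \<in> approximable" and G: "G \<in> approximable"
  shows "(\<lambda>z. G (F z)) \<in> approximable"
proof (rule approximableI)
  show "continuous_on UNIV (\<lambda>z. G (F z))"
    using continuous_on_compose2[OF approximable_cont[OF G] approximable_cont[OF F]] by simp
  fix B \<epsilon> :: real
  assume "\<epsilon> > 0"
  have "bounded (F ` cball 0 B)"
    by (intro compact_imp_bounded compact_continuous_image continuous_on_subset[OF approximable_cont[OF F]]) auto
  then obtain C where C: "C > 0" "\<And>z. norm z \<le> B \<Longrightarrow> norm (F z) \<le> C"
    unfolding bounded_pos by auto
  have "uniformly_continuous_on (cball 0 (C + 1)) G"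
    by (intro compact_uniformly_continuous continuous_on_subset[OF approximable_cont[OF G]]) auto
  then obtain \<delta> where \<delta>: "\<delta> > 0"
    "\<forall>x\<in>cball 0 (C + 1). \<forall>y\<in>cball 0 (C + 1). dist y x < \<delta> \<longrightarrow> dist (G y) (G x) < \<epsilon> / 2"
    using half_gt_zero[OF \<open>\<epsilon> > 0\<close>] unfolding uniformly_continuous_on_def by blast
  \<comment> \<open>The bound 1 keeps the approximate intermediate state in the ball of radius
    \<open>C + 1\<close>; \<delta> / 2 gives the strict inequality that uniform continuity asks
    for.\<close>
  define e where "e = min 1 (\<delta> / 2)"
  have e: "e > 0" "e \<le> 1" "e < \<delta>"
    using \<delta>(1) by (auto simp: e_def)
  obtain Ls1 s1 d1 where 1: "Ls1 \<noteq> []" "\<And>M b. (M, b) \<in> set Ls1 \<Longrightarrow> M \<in> dlor_components R"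
    "\<And>z. norm z \<le> B \<Longrightarrow> norm (s1 *\<^sub>R fold (hidden_layer \<rho>) Ls1 z + d1 - F z) \<le> e"
    using approximableE[OF F e(1)] by blast
  obtain Ls2 s2 d2 where 2: "Ls2 \<noteq> []" "\<And>M b. (M, b) \<in> set Ls2 \<Longrightarrow> M \<in> dlor_components R"
    "\<And>z. norm z \<le> C + 1 \<Longrightarrow> norm (s2 *\<^sub>R fold (hidden_layer \<rho>) Ls2 z + d2 - G z) \<le> \<epsilon> / 2"
    using approximableE[OF G half_gt_zero[OF \<open>\<epsilon> > 0\<close>]] by blast
  obtain M b Ls where Ls2: "Ls2 = (M, b) # Ls"
    using 2(1) by (metis list.exhaust surj_pair)
  define Ls' where "Ls' = Ls1 @ (s1 *\<^sub>R M, M *v d1 + b) # Ls"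
  have absorb: "hidden_layer \<rho> (s1 *\<^sub>R M, M *v d1 + b) h = hidden_layer \<rho> (M, b) (s1 *\<^sub>R h + d1)" for h
    by (simp add: hidden_layer_def matrix_vector_right_distrib scaleR_matrix_vector_assoc[symmetric]
        matrix_vector_mult_scaleR add.assoc)
  have "norm (s2 *\<^sub>R fold (hidden_layer \<rho>) Ls' z + d2 - G (F z)) \<le> \<epsilon>" if z: "norm z \<le> B" for z
  proof -
    define y where "y = s1 *\<^sub>R fold (hidden_layer \<rho>) Ls1 z + d1"
    have yF: "norm (y - F z) \<le> e"
      using 1(3)[OF z] by (simp add: y_def)
    then have y: "norm y \<le> C + 1"
      using norm_triangle_sub[of y "F z"] C(2)[OF z] e by simp
    have "F z \<in> cball 0 (C + 1)" "y \<in> cball 0 (C + 1)" "dist y (F z) < \<delta>"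
      using y C(2)[OF z] yF e by (auto simp: dist_norm)
    then have "norm (G y - G (F z)) \<le> \<epsilon> / 2"
      using \<delta>(2) unfolding dist_norm[symmetric] by (meson less_imp_le)
    moreover have "fold (hidden_layer \<rho>) Ls' z = fold (hidden_layer \<rho>) Ls2 y"
      by (simp add: Ls'_def Ls2 absorb y_def)
    ultimately show ?thesis
      using norm_diff_triangle_le[OF 2(3)[OF y]] by fastforce
  qed
  moreover have "\<forall>(M, b) \<in> set Ls'. M \<in> dlor_components R"
    using 1(2) 2(2) scaleR_dlor[OF 2(2)[of M b]] by (auto simp: Ls'_def Ls2)
  moreover have "Ls' \<noteq> []"
    by (simp add: Ls'_def)
  ultimately show "\<exists>Ls s d. Ls \<noteq> [] \<and> (\<forall>(M, b) \<in> set Ls. M \<in> dlor_components R) \<and>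
     (\<forall>z. norm z \<le> B \<longrightarrow> norm (s *\<^sub>R fold (hidden_layer \<rho>) Ls z + d - G (F z)) \<le> \<epsilon>)"
    by blast
qed

lemma approximable_closed: "locally_uniformly_closed approximable"
  unfolding locally_uniformly_closed_def
proof (intro allI impI approximableI)
  fix F :: "real^'w \<Rightarrow> real^'w" and B \<epsilon> :: real
  assume "\<forall>B. \<forall>\<epsilon>>0. \<exists>G\<in>approximable. \<forall>z. norm z \<le> B \<longrightarrow> norm (G z - F z) \<le> \<epsilon>" and "\<epsilon> > 0"
  then obtain G where G: "G \<in> approximable" "\<And>z. norm z \<le> B \<Longrightarrow> norm (G z - F z) \<le> \<epsilon> / 2"
    by (meson half_gt_zero)
  obtain Ls s d where L: "Ls \<noteq> []" "\<And>M b. (M, b) \<in> set Ls \<Longrightarrow> M \<in> dlor_components R"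
    "\<And>z. norm z \<le> B \<Longrightarrow> norm (s *\<^sub>R fold (hidden_layer \<rho>) Ls z + d - G z) \<le> \<epsilon> / 2"
    using approximableE[OF G(1) half_gt_zero[OF \<open>\<epsilon> > 0\<close>]] by blast
  have "norm (s *\<^sub>R fold (hidden_layer \<rho>) Ls z + d - F z) \<le> \<epsilon>" if "norm z \<le> B" for z
    using norm_diff_triangle_le[OF L(3)[OF that] G(2)[OF that]] by simp
  then show "\<exists>Ls s d. Ls \<noteq> [] \<and> (\<forall>(M, b) \<in> set Ls. M \<in> dlor_components R) \<and>
     (\<forall>z. norm z \<le> B \<longrightarrow> norm (s *\<^sub>R fold (hidden_layer \<rho>) Ls z + d - F z) \<le> \<epsilon>)"
    using L by (intro exI[of _ Ls] exI[of _ s] exI[of _ d]) auto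
qed

text \<open>Zooming in at \<open>c\<close>: the rescaled difference quotient tends to the identity,
  uniformly on bounded sets, because the derivative \<open>D\<close> at \<open>c\<close> is
  nonzero.\<close>

lemma activation_near_identity:
  assumes "\<epsilon> > 0"
  obtains h where "h \<noteq> 0"
    "\<And>y. \<bar>y\<bar> \<le> B \<Longrightarrow> \<bar>(\<rho> (h * y + c) - \<rho> c) / (h * D) - y\<bar> \<le> \<epsilon>"
proof -
  define C where "C = max B 1"
  have C: "C \<ge> 1" "B \<le> C"
    by (auto simp: C_def)
  define e where "e = \<epsilon> * \<bar>D\<bar> / C"
  have "e > 0"
    using assms D C by (simp add: e_def)
  then have "\<exists>d>0. \<forall>y. norm (y - c) < d \<longrightarrow> norm (\<rho> y - \<rho> c - (y - c) * D) \<le> e * norm (y - c)"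
    using deriv unfolding has_field_derivative_def has_derivative_at_alt
    by (auto simp: mult.commute)
  then obtain d where d: "d > 0"
    "\<And>y. norm (y - c) < d \<Longrightarrow> norm (\<rho> y - \<rho> c - (y - c) * D) \<le> e * norm (y - c)"
    by blast
  define h where "h = d / (2 * C)"
  have h: "h > 0" "h * C < d"
    using d(1) C by (auto simp: h_def)
  have "\<bar>(\<rho> (h * y + c) - \<rho> c) / (h * D) - y\<bar> \<le> \<epsilon>" if "\<bar>y\<bar> \<le> B" for y
  proof -
    have y: "\<bar>y\<bar> \<le> C"
      using that C by simp
    have "\<bar>h * y\<bar> \<le> h * C"
      using y h by (simp add: abs_mult)
    then have "\<bar>\<rho> (h * y + c) - \<rho> c - h * y * D\<bar> \<le> e * \<bar>h * y\<bar>"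
      using d(2)[of "h * y + c"] h by simp
    also have "\<dots> \<le> e * (h * C)"
      using \<open>\<bar>h * y\<bar> \<le> h * C\<close> \<open>e > 0\<close> by simp
    also have "\<dots> = \<epsilon> * \<bar>h * D\<bar>"
      using C h by (simp add: e_def abs_mult)
    finally have "\<bar>\<rho> (h * y + c) - \<rho> c - h * y * D\<bar> / \<bar>h * D\<bar> \<le> \<epsilon>"
      using h D by (simp add: divide_le_eq)
    moreover have "(\<rho> (h * y + c) - \<rho> c) / (h * D) - y = (\<rho> (h * y + c) - \<rho> c - h * y * D) / (h * D)"
      using h D by (simp add: field_simps)
    ultimately show ?thesis
      by (simp add: abs_divide)
  qed
  then show thesis
    using that[of h] h by blast
qed

text \<open>One layer suffices: its weights and bias shrink the affine map by \<open>h\<close> and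
  centre it at \<open>c\<close>, where \<open>\<rho>\<close> is nearly linear, and the scalar
  readout undoes shift and scaling.\<close>

lemma approximable_affine:
  fixes M :: "real^'w^'w"
  assumes M: "M \<in> dlor_components R"
  shows "(\<lambda>z. M *v z + b) \<in> approximable"
proof (rule approximableI)
  show cont_M: "continuous_on UNIV (\<lambda>z. M *v z + b)"
    by (intro continuous_intros matrix_vector_mult_linear_continuous_on)
  fix B \<epsilon> :: real
  assume "\<epsilon> > 0"
  have "bounded ((\<lambda>z. M *v z + b) ` cball 0 B)"
    by (intro compact_imp_bounded compact_continuous_image continuous_on_subset[OF cont_M]) auto
  then obtain C where C: "C > 0" "\<And>z. norm z \<le> B \<Longrightarrow> norm (M *v z + b) \<le> C"
    unfolding bounded_pos by auto
  have "\<epsilon> / CARD('w) > 0"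
    using \<open>\<epsilon> > 0\<close> by simp
  then obtain h where h: "h \<noteq> 0"
    "\<And>y. \<bar>y\<bar> \<le> C \<Longrightarrow> \<bar>(\<rho> (h * y + c) - \<rho> c) / (h * D) - y\<bar> \<le> \<epsilon> / CARD('w)"
    using activation_near_identity by blast
  define L where "L = (h *\<^sub>R M, h *\<^sub>R b + (\<chi> i. c))"
  define d :: "real^'w" where "d = (\<chi> i. - \<rho> c / (h * D))"
  have "norm ((1 / (h * D)) *\<^sub>R fold (hidden_layer \<rho>) [L] z + d - (M *v z + b)) \<le> \<epsilon>"
    if z: "norm z \<le> B" for z
  proof -
    have "norm ((1 / (h * D)) *\<^sub>R fold (hidden_layer \<rho>) [L] z + d - (M *v z + b))
        \<le> CARD('w) * (\<epsilon> / CARD('w))"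
    proof (rule norm_le_card_mult)
      fix i
      let ?y = "(M *v z + b) $ i"
      have "\<bar>?y\<bar> \<le> C"
        using component_le_norm_cart[of "M *v z + b" i] C(2)[OF z] by linarith
      moreover have y_eq: "((h *\<^sub>R M) *v z + (h *\<^sub>R b + (\<chi> i. c))) $ i = h * ?y + c"
        by (simp add: scaleR_matrix_vector_assoc[symmetric] ring_distribs)
      have "fold (hidden_layer \<rho>) [L] z $ i = \<rho> (h * ?y + c)"
        by (simp only: L_def fold_simps hidden_layer_nth y_eq)
      then have "((1 / (h * D)) *\<^sub>R fold (hidden_layer \<rho>) [L] z + d - (M *v z + b)) $ i =
          (\<rho> (h * ?y + c) - \<rho> c) / (h * D) - ?y"
        by (simp add: d_def diff_divide_distrib del: fold_simps)
      ultimately show "\<bar>((1 / (h * D)) *\<^sub>R fold (hidden_layer \<rho>) [L] z + d - (M *v z + b)) $ i\<bar>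
          \<le> \<epsilon> / CARD('w)"
        using h(2) by simp
    qed
    then show ?thesis
      by simp
  qed
  moreover have "\<forall>(M, b) \<in> set [L]. M \<in> dlor_components R"
    using scaleR_dlor[OF M] by (simp add: L_def)
  ultimately show "\<exists>Ls s d. Ls \<noteq> [] \<and> (\<forall>(M, b) \<in> set Ls. M \<in> dlor_components R) \<and>
     (\<forall>z. norm z \<le> B \<longrightarrow> norm (s *\<^sub>R fold (hidden_layer \<rho>) Ls z + d - (M *v z + b)) \<le> \<epsilon>)"
    by blast
qed

text \<open>Adding the outer product of \<open>axis i 1\<close> and \<open>v - axis i 1\<close> to
  the identity replaces its row \<open>i\<close> by \<open>v\<close>.\<close>

lemma approximable_set_affine: "set_coord i (\<lambda>z. v \<bullet> z + b) \<in> approximable"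
proof -
  obtain M where M: "M \<in> dlor_components R"
    "\<And>z. M *v z = 1 *\<^sub>R z + ((v - axis i 1) \<bullet> z) *\<^sub>R axis i 1"
    using exists_dlor_rank_one by blast
  have "(\<lambda>z. M *v z + b *\<^sub>R axis i 1) = set_coord i (\<lambda>z. v \<bullet> z + b)"
    by (auto simp: fun_eq_iff vec_eq_iff M(2) set_coord_nth axis_one_nth inner_diff_left inner_axis')
  then show ?thesis
    using approximable_affine[OF M(1)] by metis
qed

lemma approximable_set_neuron:
  fixes v :: "real^'w"
  shows "set_coord i (\<lambda>z. \<rho> (v \<bullet> z + b)) \<in> approximable"
proof (rule locally_uniformly_closedD[OF approximable_closed])
  have "continuous_on UNIV (\<lambda>z. \<rho> (v \<bullet> z + b))"
    by (rule continuous_on_compose2[OF cont]) (auto intro!: continuous_intros)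
  then have "continuous_on UNIV (\<lambda>z. if j = i then \<rho> (v \<bullet> z + b) else z $ j)" for j
    by (cases "j = i") (auto intro!: continuous_intros)
  then show "continuous_on UNIV (set_coord i (\<lambda>z. \<rho> (v \<bullet> z + b)))"
    unfolding set_coord_def by (intro continuous_on_vec_lambda)
  fix B \<epsilon> :: real
  assume "\<epsilon> > 0"
  then have "\<epsilon> / CARD('w) > 0"
    by simp
  then obtain h where h: "h \<noteq> 0"
    "\<And>y. \<bar>y\<bar> \<le> B \<Longrightarrow> \<bar>(\<rho> (h * y + c) - \<rho> c) / (h * D) - y\<bar> \<le> \<epsilon> / CARD('w)"
    using activation_near_identity by blast
  \<comment> \<open>Row \<open>i\<close> of this matrix is \<open>v\<close>, the others are those of
    \<open>h\<close> times the identity. With bias \<open>c\<close> off \<open>i\<close>, those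
    coordinates pass through the nearly linear regime.\<close>
  obtain M where M: "M \<in> dlor_components R"
    "\<And>z. M *v z = h *\<^sub>R z + ((v - h *\<^sub>R axis i 1) \<bullet> z) *\<^sub>R axis i 1"
    using exists_dlor_rank_one by blast
  define H where "H = hidden_layer \<rho> (M, \<chi> j. if j = i then b else c)"
  have H: "H z $ j = (if j = i then \<rho> (v \<bullet> z + b) else \<rho> (h * z $ j + c))" for z j
    by (auto simp: H_def hidden_layer_nth M(2) axis_one_nth inner_diff_left inner_axis')
  let ?k = "1 / (h * D)"
  \<comment> \<open>Undoing the scaling must spare coordinate \<open>i\<close>. The diagonal matrix
    with entry 1 at \<open>i\<close> and \<open>?k\<close> elsewhere is again a scalar matrix plus a
    rank-one matrix.\<close>
  obtain N where N: "N \<in> dlor_components R"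
    "\<And>z. N *v z = ?k *\<^sub>R z + (((1 - ?k) *\<^sub>R axis i 1) \<bullet> z) *\<^sub>R axis i 1"
    using exists_dlor_rank_one by blast
  define A where "A z = N *v z + (\<chi> j. if j = i then 0 else - ?k * \<rho> c)" for z
  have A: "A z $ j = (if j = i then z $ j else ?k * (z $ j - \<rho> c))" for z j
    by (auto simp: A_def N(2) axis_one_nth inner_axis' algebra_simps)
  have "norm (A (H z) - set_coord i (\<lambda>z. \<rho> (v \<bullet> z + b)) z) \<le> \<epsilon>" if "norm z \<le> B" for z
  proof -
    have "norm (A (H z) - set_coord i (\<lambda>z. \<rho> (v \<bullet> z + b)) z) \<le> CARD('w) * (\<epsilon> / CARD('w))"
    proof (rule norm_le_card_mult)
      fix j
      have "\<bar>z $ j\<bar> \<le> B"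
        using component_le_norm_cart[of z j] that by linarith
      then show "\<bar>(A (H z) - set_coord i (\<lambda>z. \<rho> (v \<bullet> z + b)) z) $ j\<bar> \<le> \<epsilon> / CARD('w)"
        using h(2)[of "z $ j"] \<open>\<epsilon> > 0\<close> by (simp add: A H set_coord_nth)
    qed
    then show ?thesis
      by simp
  qed
  moreover have "(\<lambda>z. A (H z)) \<in> approximable"
    unfolding A_def H_def by (rule approximable_comp[OF approximable_layer[OF M(1)] approximable_affine[OF N(1)]])
  ultimately show "\<exists>G\<in>approximable. \<forall>z. norm z \<le> B \<longrightarrow>
      norm (G z - set_coord i (\<lambda>z. \<rho> (v \<bullet> z + b)) z) \<le> \<epsilon>"
    by (intro bexI[of _ "\<lambda>z. A (H z)"] allI impI)
qed

text \<open>\<open>s\<close> is the working register, \<open>t\<close> the scratch register that holds the value of a single neuron.\<close>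

lemma approximable_exp_update:
  fixes w :: "real^'w"
  assumes st: "s \<noteq> t" and w: "w $ s = 0" "w $ t = 0" and nonaffine: "\<not> affine_fun \<rho>"
  shows "(\<lambda>z. set_coord t (\<lambda>_. 0) (set_coord s (\<lambda>z. z $ s * exp (w \<bullet> z)) z)) \<in> approximable"
proof -
  \<comment> \<open>Lifts an update of \<open>(l, s)\<close> to the whole state, with l =
    \<open>w \<bullet> z\<close>. As \<open>w\<close> vanishes at \<open>s\<close> and
    \<open>t\<close>, the value of l survives every \<open>P u\<close>, which makes \<open>P\<close>
    compatible with composition.\<close>
  define P where "P u z = set_coord t (\<lambda>_. 0) (set_coord s (\<lambda>z. u (w \<bullet> z, z $ s)) z)"
    for u :: "real \<times> real \<Rightarrow> real" and z
  have P_nth: "P u z $ j = (if j = t then 0 else if j = s then u (w \<bullet> z, z $ s) else z $ j)" for u z j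
    by (simp add: P_def set_coord_nth)
  have w_inner: "w \<bullet> y = w \<bullet> z" if "\<And>j. j \<noteq> s \<Longrightarrow> j \<noteq> t \<Longrightarrow> y $ j = z $ j" for y z
    unfolding inner_vec_def by (intro sum.cong refl) (metis inner_zero_left that w)
  have w_P: "w \<bullet> P u z = w \<bullet> z" for u z
    by (rule w_inner) (simp add: P_nth)
  have clear: "set_coord t (\<lambda>_. 0) \<in> approximable"
    using approximable_set_affine[of t 0 0] by simp
  interpret update_semigroup "{u. P u \<in> approximable}" \<rho>
  proof
    fix u v assume "u \<in> {u. P u \<in> approximable}" "v \<in> {u. P u \<in> approximable}"
    then have "(\<lambda>z. P v (P u z)) \<in> approximable"
      using approximable_comp[of "P u" "P v"] by simp
    moreover have "(\<lambda>z. P v (P u z)) = P (\<lambda>x. v (fst x, u x))"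
      using st by (auto simp: fun_eq_iff vec_eq_iff P_nth w_P)
    ultimately show "(\<lambda>x. v (fst x, u x)) \<in> {u. P u \<in> approximable}"
      by simp
  next
    have "P snd = set_coord t (\<lambda>_. 0)"
      by (auto simp: fun_eq_iff vec_eq_iff P_nth set_coord_nth)
    with clear show "snd \<in> {u. P u \<in> approximable}"
      by simp
  next
    fix h a b d :: real
    \<comment> \<open>From the inside out: store the neuron in \<open>t\<close>, add
      \<open>h\<close> times \<open>t\<close> to \<open>s\<close>, clear \<open>t\<close>.\<close>
    have "(\<lambda>z. set_coord t (\<lambda>_. 0) (set_coord s (\<lambda>z. (axis s 1 + h *\<^sub>R axis t 1) \<bullet> z + 0)
        (set_coord t (\<lambda>z. \<rho> ((a *\<^sub>R axis s 1 + b *\<^sub>R w) \<bullet> z + d)) z))) \<in> approximable"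
      by (rule approximable_comp[OF approximable_comp[OF approximable_set_neuron approximable_set_affine] clear])
    moreover have "(\<lambda>z. set_coord t (\<lambda>_. 0) (set_coord s (\<lambda>z. (axis s 1 + h *\<^sub>R axis t 1) \<bullet> z + 0)
        (set_coord t (\<lambda>z. \<rho> ((a *\<^sub>R axis s 1 + b *\<^sub>R w) \<bullet> z + d)) z)))
        = P (\<lambda>x. snd x + h * \<rho> (a * snd x + b * fst x + d))"
      using st by (auto simp: fun_eq_iff vec_eq_iff P_nth set_coord_nth inner_add_left inner_axis')
    ultimately show "(\<lambda>x. snd x + h * \<rho> (a * snd x + b * fst x + d)) \<in> {u. P u \<in> approximable}"
      by simp
  next
    show "locally_uniformly_closed {u. P u \<in> approximable}"
      unfolding locally_uniformly_closed_def
    proof (intro allI impI CollectI)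
      fix u :: "real \<times> real \<Rightarrow> real"
      assume u: "continuous_on UNIV u"
        and approx: "\<forall>B. \<forall>\<epsilon>>0. \<exists>g\<in>{u. P u \<in> approximable}. \<forall>x. norm x \<le> B \<longrightarrow> norm (g x - u x) \<le> \<epsilon>"
      show "P u \<in> approximable"
      proof (rule locally_uniformly_closedD[OF approximable_closed])
        have "continuous_on UNIV (\<lambda>z. u (w \<bullet> z, z $ s))"
          by (rule continuous_on_compose2[OF u]) (auto intro!: continuous_intros)
        then have "continuous_on UNIV (\<lambda>z. P u z $ j)" for j
          unfolding P_nth by (cases "j = t"; cases "j = s") (auto intro!: continuous_intros)
        then show "continuous_on UNIV (P u)"
          using continuous_on_vec_lambda[of UNIV "\<lambda>j z. P u z $ j"] by simp
        fix B \<epsilon> :: real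
        assume "\<epsilon> > 0"
        then obtain g where g: "P g \<in> approximable"
          "\<And>x. norm x \<le> norm w * B + B \<Longrightarrow> norm (g x - u x) \<le> \<epsilon>"
          using approx by blast
        have "norm (P g z - P u z) \<le> \<epsilon>" if z: "norm z \<le> B" for z
        proof -
          let ?x = "(w \<bullet> z, z $ s)"
          have "\<bar>w \<bullet> z\<bar> \<le> norm w * B"
            using Cauchy_Schwarz_ineq2[of w z] mult_left_mono[OF z norm_ge_zero[of w]] by linarith
          moreover have "\<bar>z $ s\<bar> \<le> B"
            using component_le_norm_cart[of z s] z by linarith
          ultimately have "norm ?x \<le> norm w * B + B"
            using norm_Pair_le[of "w \<bullet> z" "z $ s"] by simp
          moreover have "P g z - P u z = (g ?x - u ?x) *\<^sub>R axis s 1"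
            using st by (auto simp: vec_eq_iff P_nth axis_def)
          ultimately show ?thesis
            using g(2) by (simp add: norm_axis_1)
        qed
        then show "\<exists>G\<in>approximable. \<forall>z. norm z \<le> B \<longrightarrow> norm (G z - P u z) \<le> \<epsilon>"
          using g(1) by blast
      qed
    qed
  qed (rule cont)
  have "P (\<lambda>x. snd x * exp (fst x)) \<in> approximable"
    using exponential_update[OF nonaffine] by blast
  then show ?thesis
    unfolding P_def by simp
qed

lemma approximable_exp_accumulate:
  fixes w :: "real^'w"
  assumes "s \<noteq> t" "w $ s = 0" "w $ t = 0" "\<not> affine_fun \<rho>" "i \<noteq> s" "i \<noteq> t"
  obtains F where "F \<in> approximable"
    "\<And>z j. j \<noteq> s \<Longrightarrow> j \<noteq> t \<Longrightarrow> F z $ j = (if j = i then z $ i + a * exp (w \<bullet> z) else z $ j)"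
proof -
  \<comment> \<open>From the inside out: set \<open>s\<close> to 1, multiply it by the exponential,
    clear \<open>t\<close>, add \<open>a\<close> times \<open>s\<close> to register
    \<open>i\<close>.\<close>
  define F where "F z = set_coord i (\<lambda>z. (axis i 1 + a *\<^sub>R axis s 1) \<bullet> z + 0)
    (set_coord t (\<lambda>_. 0) (set_coord s (\<lambda>z. z $ s * exp (w \<bullet> z)) (set_coord s (\<lambda>z. 0 \<bullet> z + 1) z)))" for z
  have "F \<in> approximable"
    unfolding F_def
    by (rule approximable_comp[OF approximable_comp[OF approximable_set_affine
            approximable_exp_update[OF assms(1-4)]] approximable_set_affine])
  moreover have "w \<bullet> set_coord s (\<lambda>z. 0 \<bullet> z + 1) z = w \<bullet> z" for z
    unfolding inner_vec_def using assms(2) by (intro sum.cong) (auto simp: set_coord_nth)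
  then have "F z $ j = (if j = i then z $ i + a * exp (w \<bullet> z) else z $ j)" if "j \<noteq> s" "j \<noteq> t" for z j
    using that assms by (auto simp: F_def set_coord_nth inner_add_left inner_axis')
  ultimately show thesis
    using that by blast
qed

end

section \<open>Uniform approximation\<close>

text \<open>Generated by addition so that induction follows the program: each term is one
  accumulation, each sum a composition.\<close>

inductive_set exp_sums :: "(real^'n::finite \<Rightarrow> real) set" where
  exp_term: "(\<lambda>x. a * exp (v \<bullet> x)) \<in> exp_sums"
| add: "f \<in> exp_sums \<Longrightarrow> g \<in> exp_sums \<Longrightarrow> (\<lambda>x. f x + g x) \<in> exp_sums"

lemma exp_term_mult_exp_sums: "g \<in> exp_sums \<Longrightarrow> (\<lambda>x. a * exp (v \<bullet> x) * g x) \<in> exp_sums"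
proof (induction rule: exp_sums.induct)
  case (exp_term b w)
  have "(\<lambda>x. (a * b) * exp ((v + w) \<bullet> x)) \<in> exp_sums"
    by (rule exp_sums.exp_term)
  then show ?case
    by (simp add: inner_add_left exp_add mult.assoc mult.left_commute)
next
  case (add f g)
  then show ?case
    using exp_sums.add by (fastforce simp: ring_distribs)
qed

lemma exp_sums_dense:
  fixes f :: "real^'n \<Rightarrow> real"
  assumes "compact K" "continuous_on K f" "\<epsilon> > 0"
  obtains g where "g \<in> exp_sums" "\<And>x. x \<in> K \<Longrightarrow> \<bar>f x - g x\<bar> < \<epsilon>"
proof -
  interpret function_ring_on exp_sums K
  proof
    show "continuous_on K g" if "g \<in> exp_sums" for g
      using that by induction (auto intro!: continuous_intros)
    show "(\<lambda>x. g x * h x) \<in> exp_sums" if "g \<in> exp_sums" "h \<in> exp_sums" for g h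
      using that
      by (induction rule: exp_sums.induct)
        (use exp_term_mult_exp_sums exp_sums.add in \<open>fastforce simp: ring_distribs\<close>)+
    show "(\<lambda>_. a) \<in> exp_sums" for a
      using exp_term[of a 0] by simp
    \<comment> \<open>For the direction \<open>x - y\<close> the two exponents differ by the squared
      distance of the points.\<close>
    show "\<exists>g\<in>exp_sums. g x \<noteq> g y" if "x \<noteq> y" for x y
    proof
      have "(x - y) \<bullet> x - (x - y) \<bullet> y \<noteq> 0"
        using that by (simp add: inner_diff_right[symmetric])
      then show "1 * exp ((x - y) \<bullet> x) \<noteq> 1 * exp ((x - y) \<bullet> y)"
        by simp
    qed (rule exp_term)
  qed (use assms exp_sums.add in auto)
  show thesis
    using Stone_Weierstrass_basic[OF assms(2,3)] that by blast
qed

section \<open>Assembling the networks\<close>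

lemma continuous_on_zero_pad: "continuous_on S (zero_pad :: real^'n \<Rightarrow> real^('n + 'k::finite))"
proof -
  have "continuous_on S (\<lambda>x :: real^'n. case i :: 'n + 'k of Inl j \<Rightarrow> x $ j | Inr _ \<Rightarrow> 0)" for i
    by (cases i) (auto intro!: continuous_intros)
  then show ?thesis
    unfolding zero_pad_def by (intro continuous_on_vec_lambda)
qed

lemma continuous_on_deep_net:
  assumes "continuous_on UNIV \<rho>"
  shows "continuous_on S (deep_net \<rho> Ls A a)"
proof -
  have "continuous_on S (\<lambda>x. fold (hidden_layer \<rho>) Ls (zero_pad x))"
    by (rule continuous_on_compose2[OF continuous_on_fold_hidden_layer[OF assms] continuous_on_zero_pad]) simp
  then have "continuous_on S (\<lambda>x. A *v fold (hidden_layer \<rho>) Ls (zero_pad x))"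
    by (rule continuous_on_compose2[OF matrix_vector_mult_linear_continuous_on[of UNIV]]) simp
  then show ?thesis
    unfolding deep_net_def by (intro continuous_intros)
qed

context dlor_activation
begin

text \<open>Register layout: \<open>Inl j\<close> holds the inputs, \<open>Inr (Inl i)\<close> the
  outputs, \<open>Inr (Inr 0)\<close> is the working and \<open>Inr (Inr 1)\<close> the scratch
  register. The last two are left unspecified in the conclusion.\<close>

lemma approximable_accumulate:
  fixes i :: "'m::finite" and g :: "real^'n \<Rightarrow> real"
  assumes nonaffine: "\<not> affine_fun \<rho>" and g: "g \<in> exp_sums"
  obtains F :: "real^('n + ('m + 2)) \<Rightarrow> real^('n + ('m + 2))" where "F \<in> approximable"
    "\<And>z j. F z $ Inl j = z $ Inl j"
    "\<And>z j. F z $ Inr (Inl j) =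
      (if j = i then z $ Inr (Inl i) + g (\<chi> j. z $ Inl j) else z $ Inr (Inl j))"
proof -
  have "\<exists>F :: real^('n + ('m + 2)) \<Rightarrow> real^('n + ('m + 2)). F \<in> approximable \<and>
      (\<forall>z j. F z $ Inl j = z $ Inl j) \<and>
      (\<forall>z j. F z $ Inr (Inl j) =
        (if j = i then z $ Inr (Inl i) + g (\<chi> j. z $ Inl j) else z $ Inr (Inl j)))"
    using g
  proof induction
    case (exp_term a v)
    define w :: "real^('n + ('m + 2))" where "w = zero_pad v"
    have w: "w \<bullet> z = v \<bullet> (\<chi> j. z $ Inl j)" for z
      by (simp add: inner_vec_def w_def zero_pad_def UNIV_Plus_UNIV[symmetric] sum.Plus
          del: UNIV_Plus_UNIV)
    have *: "Inr (Inr 0) \<noteq> (Inr (Inr 1) :: 'n + ('m + 2))"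
      "w $ Inr (Inr 0) = 0" "w $ Inr (Inr 1) = 0"
      by (simp_all add: w_def zero_pad_def)
    obtain F where "F \<in> approximable" "\<And>z j. j \<noteq> Inr (Inr 0) \<Longrightarrow> j \<noteq> Inr (Inr 1) \<Longrightarrow> F z $ j =
        (if j = Inr (Inl i) then z $ Inr (Inl i) + a * exp (w \<bullet> z) else z $ j)"
      using approximable_exp_accumulate[OF * nonaffine, of "Inr (Inl i)" a] by auto
    then show ?case
      using w by (intro exI[of _ F]) auto
  next
    case (add f g)
    then obtain F G :: "real^('n + ('m + 2)) \<Rightarrow> real^('n + ('m + 2))"
      where F: "F \<in> approximable" "\<And>z j. F z $ Inl j = z $ Inl j"
        "\<And>z j. F z $ Inr (Inl j) =
          (if j = i then z $ Inr (Inl i) + f (\<chi> j. z $ Inl j) else z $ Inr (Inl j))"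
        and G: "G \<in> approximable" "\<And>z j. G z $ Inl j = z $ Inl j"
        "\<And>z j. G z $ Inr (Inl j) =
          (if j = i then z $ Inr (Inl i) + g (\<chi> j. z $ Inl j) else z $ Inr (Inl j))"
      by blast
    show ?case
      using approximable_comp[OF F(1) G(1)] by (intro exI[of _ "\<lambda>z. G (F z)"]) (simp add: F G)
  qed
  then show thesis
    using that by blast
qed

lemma approximable_outputs:
  fixes g :: "'m::finite \<Rightarrow> real^'n \<Rightarrow> real"
  assumes nonaffine: "\<not> affine_fun \<rho>" and g: "\<And>i. g i \<in> exp_sums"
  obtains F :: "real^('n + ('m + 2)) \<Rightarrow> real^('n + ('m + 2))" where "F \<in> approximable"
    "\<And>z i. F z $ Inr (Inl i) = z $ Inr (Inl i) + g i (\<chi> j. z $ Inl j)"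
proof -
  have "\<exists>F :: real^('n + ('m + 2)) \<Rightarrow> real^('n + ('m + 2)). F \<in> approximable \<and>
      (\<forall>z j. F z $ Inl j = z $ Inl j) \<and>
      (\<forall>z i. F z $ Inr (Inl i) =
        (if i \<in> I then z $ Inr (Inl i) + g i (\<chi> j. z $ Inl j) else z $ Inr (Inl i)))" for I
    using finite[of I]
  proof induction
    case empty
    \<comment> \<open>Clearing the working register acts as the identity on inputs and
      outputs.\<close>
    have "set_coord (Inr (Inr 0)) (\<lambda>z. 0 \<bullet> z + 0) \<in> approximable"
      by (rule approximable_set_affine)
    then show ?case
      by (intro exI[of _ "set_coord (Inr (Inr 0)) (\<lambda>z. 0 \<bullet> z + 0)"]) (simp add: set_coord_nth)
  next
    case (insert k I)
    then obtain F :: "real^('n + ('m + 2)) \<Rightarrow> real^('n + ('m + 2))"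
      where F: "F \<in> approximable" "\<And>z j. F z $ Inl j = z $ Inl j"
        "\<And>z i. F z $ Inr (Inl i) =
          (if i \<in> I then z $ Inr (Inl i) + g i (\<chi> j. z $ Inl j) else z $ Inr (Inl i))"
      by blast
    obtain G :: "real^('n + ('m + 2)) \<Rightarrow> real^('n + ('m + 2))"
      where G: "G \<in> approximable" "\<And>z j. G z $ Inl j = z $ Inl j"
        "\<And>z j. G z $ Inr (Inl j) =
          (if j = k then z $ Inr (Inl k) + g k (\<chi> j. z $ Inl j) else z $ Inr (Inl j))"
      using approximable_accumulate[OF nonaffine g[of k], of k] by blast
    show ?case
      using approximable_comp[OF F(1) G(1)] insert.hyps
      by (intro exI[of _ "\<lambda>z. G (F z)"]) (simp add: F G)
  qed
  from this[of UNIV] show thesis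
    using that by auto
qed

text \<open>Zero padding starts the output registers at 0, so they end with the exponential sums
  themselves. The matrix \<open>A\<close> selects these registers and applies the scalar readout,
  and \<open>a\<close> applies the shift.\<close>

lemma deep_dlor_network_approximates:
  fixes f :: "real^'n \<Rightarrow> real^'m"
  assumes nonaffine: "\<not> affine_fun \<rho>" and K: "compact K" and f: "continuous_on K f"
    and "\<epsilon> > 0"
  obtains N :: "real^'n \<Rightarrow> real^'m" where "N \<in> deep_dlor_networks \<rho> R TYPE('m + 2)"
    "\<And>x. x \<in> K \<Longrightarrow> norm (N x - f x) \<le> \<epsilon>"
proof -
  \<comment> \<open>Per output coordinate, one half is spent on the exponential sum and one on the
    network.\<close>
  define e where "e = \<epsilon> / CARD('m) / 2"
  have e: "e > 0" "e + e = \<epsilon> / CARD('m)"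
    using \<open>\<epsilon> > 0\<close> by (auto simp: e_def)
  have "\<exists>g\<in>exp_sums. \<forall>x\<in>K. \<bar>f x $ i - g x\<bar> < e" for i
    using exp_sums_dense[OF K _ e(1), of "\<lambda>x. f x $ i"] f by (metis continuous_on_component)
  then obtain g where g: "\<And>i. g i \<in> exp_sums" "\<And>i x. x \<in> K \<Longrightarrow> \<bar>f x $ i - g i x\<bar> < e"
    by metis
  obtain F :: "real^('n + ('m + 2)) \<Rightarrow> real^('n + ('m + 2))" where F: "F \<in> approximable"
    "\<And>z i. F z $ Inr (Inl i) = z $ Inr (Inl i) + g i (\<chi> j. z $ Inl j)"
    by (rule approximable_outputs[of g, OF nonaffine g(1)]) (rule that)
  have "bounded (zero_pad ` K :: (real^('n + ('m + 2))) set)"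
    by (intro compact_imp_bounded compact_continuous_image continuous_on_zero_pad K)
  then obtain B where B: "\<And>x. x \<in> K \<Longrightarrow> norm (zero_pad x :: real^('n + ('m + 2))) \<le> B"
    unfolding bounded_iff by auto
  obtain Ls s d where L: "Ls \<noteq> []" "\<And>M b. (M, b) \<in> set Ls \<Longrightarrow> M \<in> dlor_components R"
    "\<And>z. norm z \<le> B \<Longrightarrow> norm (s *\<^sub>R fold (hidden_layer \<rho>) Ls z + d - F z) \<le> e"
    using approximableE[OF F(1) e(1)] by blast
  define A :: "real^('n + ('m + 2))^'m" where "A = (\<chi> i k. if k = Inr (Inl i) then s else 0)"
  define a :: "real^'m" where "a = (\<chi> i. d $ Inr (Inl i))"
  have "norm (deep_net \<rho> Ls A a x - f x) \<le> \<epsilon>" if x: "x \<in> K" for x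
  proof -
    define z :: "real^('n + ('m + 2))" where "z = zero_pad x"
    define y where "y = s *\<^sub>R fold (hidden_layer \<rho>) Ls z + d"
    have "norm (deep_net \<rho> Ls A a x - f x) \<le> CARD('m) * (\<epsilon> / CARD('m))"
    proof (rule norm_le_card_mult)
      fix i
      have "(A *v h) $ i = s * h $ Inr (Inl i)" for h
        by (simp add: A_def matrix_vector_mult_def if_distrib[where f = "\<lambda>a. a * _"] cong: if_cong)
      then have "deep_net \<rho> Ls A a x $ i = y $ Inr (Inl i)"
        by (simp add: deep_net_def y_def a_def z_def)
      moreover have "F z $ Inr (Inl i) = g i x"
        by (simp add: F(2) z_def zero_pad_def)
      moreover have "\<bar>(y - F z) $ Inr (Inl i)\<bar> \<le> e"
        using L(3)[of z] B[OF x] component_le_norm_cart[of "y - F z" "Inr (Inl i)"]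
        unfolding y_def z_def by linarith
      ultimately show "\<bar>(deep_net \<rho> Ls A a x - f x) $ i\<bar> \<le> \<epsilon> / CARD('m)"
        using g(2)[OF x, of i] e(2) by simp
    qed
    then show ?thesis
      by simp
  qed
  moreover have "deep_net \<rho> Ls A a \<in> deep_dlor_networks \<rho> R TYPE('m + 2)"
    unfolding deep_dlor_networks_def using L(1,2) by blast
  ultimately show thesis
    using that by blast
qed

end

section \<open>From uniform approximation on \<open>K\<close> to density in the function
  space\<close>

lemma dense_in_CI:
  fixes F :: "(real^'n \<Rightarrow> real^'m) set"
  assumes K: "compact K" and cont: "\<And>f. f \<in> F \<Longrightarrow> continuous_on K f"
    and dense: "\<And>f \<epsilon>. continuous_on K f \<Longrightarrow> \<epsilon> > 0 \<Longrightarrow> \<exists>g\<in>F. \<forall>x\<in>K. norm (g x - f x) \<le> \<epsilon>"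
  shows "dense_in_C K F"
proof -
  define C where "C = cfunspace (top_of_set K) (euclidean_metric :: (real^'m) metric)"
  have "compactin (top_of_set K) (topspace (top_of_set K))"
    using K by (simp add: compactin_subtopology)
  then have C: "mspace C = {f. f \<in> extensional K \<and> continuous_on K f}"
    unfolding C_def by (subst compactin_mspace_cfunspace) auto
  have sub: "(\<lambda>f. restrict f K) ` F \<subseteq> mspace C"
    using cont by (auto simp: C cong: continuous_on_cong)
  interpret Metric_space "mspace C" "mdist C"
    by (rule Metric_space_mspace_mdist)
  have "\<exists>g\<in>(\<lambda>f. restrict f K) ` F. g \<in> mball f r" if f: "f \<in> mspace C" and "r > 0" for f r
  proof -
    \<comment> \<open>Half the radius, because the pointwise bounds give a non-strict bound on the
      supremum while balls are open.\<close>
    obtain g where g: "g \<in> F" "\<And>x. x \<in> K \<Longrightarrow> norm (g x - f x) \<le> r / 2"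
      using dense[of f "r / 2"] f \<open>r > 0\<close> by (auto simp: C)
    have "mdist C f (restrict g K) \<le> r / 2"
      unfolding C_def using g(2) \<open>r > 0\<close>
      by (intro mdist_cfunspace_le) (auto simp: dist_norm norm_minus_commute)
    then have "restrict g K \<in> mball f r"
      using f sub g(1) \<open>r > 0\<close> by (auto simp: in_mball)
    then show ?thesis
      using g(1) by blast
  qed
  then have "mtopology closure_of ((\<lambda>f. restrict f K) ` F) = mspace C"
    unfolding metric_closure_of by blast
  then show ?thesis
    using sub unfolding dense_in_C_def Let_def C_def[symmetric] mtopology_of_def by blast
qed

text \<open>The padding type \<open>'m + 2\<close> has m + 2 elements, which makes the width n + m +
  2; n, m and r are at least 1 as cardinalities of finite types.\<close>

theorem theorem5:
  fixes \<rho> :: "real \<Rightarrow> real" and c :: real and K :: "(real^'n) set"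
  assumes "continuous_on UNIV \<rho>"
    and "\<not> affine_fun \<rho>"
    and "continuously_differentiable_at \<rho> c"
    and "deriv \<rho> c \<noteq> 0"
    and "compact K"
  shows "dense_in_C K
           (deep_dlor_networks \<rho> TYPE('r::finite) TYPE('m + 2) :: (real^'n \<Rightarrow> real^'m) set)"
proof -
  have "\<rho> differentiable (at c)"
    using assms(3) unfolding continuously_differentiable_at_def by (meson eventually_nhds_x_imp_x)
  then have "(\<rho> has_real_derivative deriv \<rho> c) (at c)"
    using DERIV_deriv_iff_real_differentiable by blast
  then interpret dlor_activation \<rho> c "deriv \<rho> c" "TYPE('r)"
    using assms by unfold_locales
  show ?thesis
  proof (rule dense_in_CI[OF assms(5)])
    show "continuous_on K f" if "f \<in> deep_dlor_networks \<rho> TYPE('r) TYPE('m + 2)"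
      for f :: "real^'n \<Rightarrow> real^'m"
      using that continuous_on_deep_net[OF assms(1)] unfolding deep_dlor_networks_def by blast
    show "\<exists>g\<in>deep_dlor_networks \<rho> TYPE('r) TYPE('m + 2). \<forall>x\<in>K. norm (g x - f x) \<le> \<epsilon>"
      if "continuous_on K f" "\<epsilon> > 0" for f :: "real^'n \<Rightarrow> real^'m" and \<epsilon>
      using deep_dlor_network_approximates[OF assms(2,5) that] by metis
  qed
qed

end
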